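(* Consider a nonholonomic system with constraint submanifold $\mathcal{M}\subset T^*Q$, distribution $\mathcal{C}$ on $\mathcal{M}$, 2-form $\Omega_{\mathcal M}$ and section $\Omega_{\mathcal C}$ as described in the context. Let $\pi_{\mathrm{nh}}$ be the bivector field on $\mathcal{M}$ characterized by $\pi_{\mathrm{nh}}^\sharp(\alpha)=-X$ if and only if $\mathbf{i}_X\Omega_{\mathcal C}=\alpha|_{\mathcal C}$ ($X\in\Gamma(\mathcal C)$, $\alpha\in\Omega^1(\mathcal M)$), and let $\{\cdot,\cdot\}_{\mathrm{nh}}$ be the corresponding bracket. Then: (i) The almost Dirac structures $L_{\pi_{\mathrm{nh}}}=\mathrm{graph}(\pi_{\mathrm{nh}}^\sharp)=\{(\pi_{\mathrm{nh}}^\sharp(\alpha),\alpha)\}$ and $$L_{\mathrm{nh}}=\{(X,\alpha)\in T\mathcal{M}\oplus T^*\mathcal{M}:X\in\mathcal{C},\ \mathbf{i}_X\Omega_{\mathcal M}|_{\mathcal C}=-\alpha|_{\mathcal C}\}$$ coincide. (ii) The bracket $\{\cdot,\cdot\}_{\mathrm{nh}}$ coincides with the classical almost Poisson bracket for nonholonomic systems, i.e. with $$\{f,g\}=\Omega_{Q}(\mathcal{P}Y_{\bar f},\mathcal{P}Y_{\bar g})\big|_{\mathcal M},\qquad f,g\in C^\infty(\mathcal{M}),$$ where $\bar f,\bar g$ are arbitrary smooth extensions of $f,g$ to $T^*Q$, $Y_{\bar f}$ is defined by $\mathbf{i}_{Y_{\bar f}}\Omega_Q=d\bar f$, and $\mathcal{P}:T_{\mathcal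 M}(T^*Q)\to\mathcal{C}$ is the projector associated with the decomposition $T_{\mathcal M}(T^*Q)=\mathcal{C}\oplus\mathcal{C}^{\Omega_Q}$.
   Context: Nonholonomic system: $Q$ is an $n$-dimensional manifold, $\mathcal{L}(q,\dot q)=\frac12\mathcal{G}(q)(\dot q,\dot q)-V(q)$ a Lagrangian with $\mathcal{G}$ a Riemannian metric, and $\mathcal{D}\subset TQ$ a regular non-integrable distribution given as the annihilator of an $\mathbb{R}^k$-valued 1-form $\epsilon$ of constant rank $k<n$. Let $\mathrm{Leg}:TQ\to T^*Q$ be the Legendre transform, $\mathcal{M}=\mathrm{Leg}(\mathcal{D})$ (a vector subbundle of $T^*Q$), $\iota:\mathcal{M}\hookrightarrow T^*Q$ the inclusion, $\tau:T^*Q\to Q$ the projection, $\Omega_Q=-d\Theta$ the canonical symplectic form ($\Omega_Q=\sum dq^i\wedge dp_i$), $\Omega_{\mathcal M}=\iota^*\Omega_Q$. Set $\mathcal{F}=\{v\in T(T^*Q):\langle\tau^*\epsilon,v\rangle=0\}$ and $\mathcal{C}=T\mathcal{M}\cap\mathcal{F}$. It is known that $\mathcal{C}$ is a regular distribution of rank $2(n-k)$ on $\mathcal{M}$, that the point-wise restriction $\Omega_{\mathcal C}\in\Gamma(\bigwedge^2\mathcal{C}^* )$ of $\Omega_{\mathcal M}$ to $\mathcal{C}$ is nondegenerate, and that along $\mathcal{M}$ one has $T_{\mathcal M}(T^*Q)=\mathcal{C}\oplus\mathcal{C}^{\Omega_Q}$, where $\mathcal{C}^{\Omega_Q}$ is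 the symplectic orthogonal. For a bivector field $\pi$: $\beta(\pi^\sharp(\alpha))=\pi(\alpha,\beta)$ and $\{f,g\}=\pi(df,dg)$. An almost Dirac structure is a subbundle of $T\mathcal{M}\oplus T^*\mathcal{M}$ maximal isotropic for $\langle(X,\alpha),(Y,\beta)\rangle=\alpha(Y)+\beta(X)$. *)

theory Defs
  imports "HOL-Analysis.Analysis" "HOL-Library.Function_Algebras"
begin

text \<open>
  Smooth manifolds are given by atlases, without any topology on the underlying type.  Tangent
  vectors are families of coordinate vectors, one for each chart around the base point, related by
  the Jacobians of the transition maps; they form a linear subspace of the function type
  below.  Covectors are linear functionals on a tangent space, extended by 0.
\<close>

instantiation "fun" :: (type, real_vector) real_vector
begin

definition scaleR_fun :: "real \<Rightarrow> ('a \<Rightarrow> 'b) \<Rightarrow> 'a \<Rightarrow> 'b"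
  where "scaleR_fun r f = (\<lambda>x. r *\<^sub>R f x)"

instance
  by standard (auto simp: scaleR_fun_def fun_eq_iff scaleR_add_right scaleR_add_left)

end

definition linear_on_sub :: "'a::real_vector set \<Rightarrow> ('a \<Rightarrow> 'b::real_vector) \<Rightarrow> bool"
  where "linear_on_sub V f \<longleftrightarrow>
    (\<forall>x\<in>V. \<forall>y\<in>V. f (x + y) = f x + f y) \<and> (\<forall>x\<in>V. \<forall>r. f (r *\<^sub>R x) = r *\<^sub>R f x)"


section \<open>Smooth functions on open subsets of Euclidean spaces\<close>

text \<open>Both notions are meant for open \<open>S\<close>.\<close>

primrec Ck_on :: "nat \<Rightarrow> 'e::euclidean_space set \<Rightarrow> ('e \<Rightarrow> 'f::real_normed_vector) \<Rightarrow> bool"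
  where
    "Ck_on 0 S f \<longleftrightarrow> continuous_on S f"
  | "Ck_on (Suc k) S f \<longleftrightarrow>
       f differentiable_on S \<and> (\<forall>v. Ck_on k S (\<lambda>x. frechet_derivative f (at x) v))"

definition smooth_on :: "'e::euclidean_space set \<Rightarrow> ('e \<Rightarrow> 'f::real_normed_vector) \<Rightarrow> bool"
  where "smooth_on S f \<longleftrightarrow> (\<forall>k. Ck_on k S f)"


section \<open>Smooth manifolds\<close>

type_synonym ('a, 'e) chart = "'a set \<times> ('a \<Rightarrow> 'e)"
type_synonym ('a, 'e) atlas = "('a, 'e) chart set"
type_synonym ('a, 'e) tvec = "('a, 'e) chart \<Rightarrow> 'e"
type_synonym ('a, 'e) covec = "('a, 'e) tvec \<Rightarrow> real"

definition cinv :: "('a, 'e) chart \<Rightarrow> 'e \<Rightarrow> 'a"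
  where "cinv c = inv_into (fst c) (snd c)"

definition points :: "('a, 'e) atlas \<Rightarrow> 'a set"
  where "points A = (\<Union>c\<in>A. fst c)"

definition charts_at :: "('a, 'e) atlas \<Rightarrow> 'a \<Rightarrow> ('a, 'e) chart set"
  where "charts_at A p = {c \<in> A. p \<in> fst c}"

text \<open>An arbitrary chart around \<open>p\<close>; what is computed with it below does not depend on the choice.\<close>

definition chart_at :: "('a, 'e) atlas \<Rightarrow> 'a \<Rightarrow> ('a, 'e) chart"
  where "chart_at A p = (SOME c. c \<in> charts_at A p)"

definition mtop :: "('a, 'e::euclidean_space) atlas \<Rightarrow> 'a topology"
  where "mtop A =
    topology (\<lambda>W. W \<subseteq> points A \<and> (\<forall>c\<in>A. open (snd c ` (fst c \<inter> W))))"

definition smooth_manifold :: "('a, 'e::euclidean_space) atlas \<Rightarrow> bool"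
  where "smooth_manifold A \<longleftrightarrow>
    (\<forall>c\<in>A. inj_on (snd c) (fst c) \<and> open (snd c ` fst c)) \<and>
    (\<forall>c\<in>A. \<forall>d\<in>A. open (snd c ` (fst c \<inter> fst d)) \<and>
       smooth_on (snd c ` (fst c \<inter> fst d)) (snd d \<circ> cinv c)) \<and>
    Hausdorff_space (mtop A) \<and> second_countable (mtop A)"

definition tangent_space :: "('a, 'e::euclidean_space) atlas \<Rightarrow> 'a \<Rightarrow> ('a, 'e) tvec set"
  where "tangent_space A p =
    {v. (\<forall>c. c \<notin> charts_at A p \<longrightarrow> v c = 0) \<and>
        (\<forall>c\<in>charts_at A p. \<forall>d\<in>charts_at A p.
           v d = frechet_derivative (snd d \<circ> cinv c) (at (snd c p)) (v c))}"

definition cotangent_space :: "('a, 'e::euclidean_space) atlas \<Rightarrow> 'a \<Rightarrow> ('a, 'e) covec set"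
  where "cotangent_space A p =
    {\<alpha>. linear_on_sub (tangent_space A p) \<alpha> \<and> (\<forall>v. v \<notin> tangent_space A p \<longrightarrow> \<alpha> v = 0)}"

text \<open>The tangent vector at \<open>p\<close> with coordinates \<open>e\<close> in the chart \<open>c\<close>, and for \<open>b\<close> in the
  standard basis the covector \<open>dx\<^sup>b\<close> of \<open>c\<close> at \<open>p\<close>.\<close>

definition coord_vec ::
  "('a, 'e::euclidean_space) atlas \<Rightarrow> ('a, 'e) chart \<Rightarrow> 'a \<Rightarrow> 'e \<Rightarrow> ('a, 'e) tvec"
  where "coord_vec A c p e = (\<lambda>d. if d \<in> charts_at A p
    then frechet_derivative (snd d \<circ> cinv c) (at (snd c p)) e else 0)"

definition coord_covec ::
  "('a, 'e::euclidean_space) atlas \<Rightarrow> ('a, 'e) chart \<Rightarrow> 'a \<Rightarrow> 'e \<Rightarrow> ('a, 'e) covec"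
  where "coord_covec A c p b = (\<lambda>v. if v \<in> tangent_space A p then v c \<bullet> b else 0)"

definition smooth_fun ::
  "('a, 'e::euclidean_space) atlas \<Rightarrow> 'a set \<Rightarrow> ('a \<Rightarrow> 'f::real_normed_vector) \<Rightarrow> bool"
  where "smooth_fun A W f \<longleftrightarrow> (\<forall>c\<in>A. smooth_on (snd c ` (fst c \<inter> W)) (f \<circ> cinv c))"

definition differential ::
  "('a, 'e::euclidean_space) atlas \<Rightarrow> ('a \<Rightarrow> 'f::real_normed_vector) \<Rightarrow> 'a \<Rightarrow> ('a, 'e) tvec \<Rightarrow> 'f"
  where "differential A f p v = (let c = chart_at A p in
    if v \<in> tangent_space A p then frechet_derivative (f \<circ> cinv c) (at (snd c p)) (v c) else 0)"

text \<open>Openness of the chart preimages in the next definition expresses continuity of \<open>F\<close>.\<close>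

definition smooth_map ::
  "('a, 'e::euclidean_space) atlas \<Rightarrow> ('b, 'f::euclidean_space) atlas \<Rightarrow> ('a \<Rightarrow> 'b) \<Rightarrow> bool"
  where "smooth_map A B F \<longleftrightarrow> F ` points A \<subseteq> points B \<and>
    (\<forall>c\<in>A. \<forall>d\<in>B. open (snd c ` (fst c \<inter> F -` fst d)) \<and>
       smooth_on (snd c ` (fst c \<inter> F -` fst d)) (snd d \<circ> F \<circ> cinv c))"

definition tangent_map ::
  "('a, 'e::euclidean_space) atlas \<Rightarrow> ('b, 'f::euclidean_space) atlas \<Rightarrow> ('a \<Rightarrow> 'b)
    \<Rightarrow> 'a \<Rightarrow> ('a, 'e) tvec \<Rightarrow> ('b, 'f) tvec"
  where "tangent_map A B F p v = (let c = chart_at A p in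
    (\<lambda>d. if d \<in> charts_at B (F p)
      then frechet_derivative (snd d \<circ> F \<circ> cinv c) (at (snd c p)) (v c) else 0))"

text \<open>\<open>B\<close> is the smooth structure of an embedded submanifold: the inclusion is a smooth immersion
  and a homeomorphism onto its image.\<close>

definition embedded_submanifold ::
  "('a, 'm::euclidean_space) atlas \<Rightarrow> ('a, 'e::euclidean_space) atlas \<Rightarrow> bool"
  where "embedded_submanifold B A \<longleftrightarrow>
    smooth_manifold B \<and> smooth_map B A (\<lambda>x. x) \<and>
    (\<forall>p\<in>points B. inj_on (tangent_map B A (\<lambda>x. x) p) (tangent_space B p)) \<and>
    mtop B = subtopology (mtop A) (points B)"


section \<open>Tensor fields\<close>

definition smooth_one_form ::
  "('a, 'e::euclidean_space) atlas \<Rightarrow> ('a \<Rightarrow> ('a, 'e) tvec \<Rightarrow> 'f::real_normed_vector) \<Rightarrow> bool"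
  where "smooth_one_form A \<omega> \<longleftrightarrow>
    (\<forall>p\<in>points A. linear_on_sub (tangent_space A p) (\<omega> p)) \<and>
    (\<forall>c\<in>A. \<forall>e. smooth_on (snd c ` fst c) (\<lambda>x. \<omega> (cinv c x) (coord_vec A c (cinv c x) e)))"

definition pullback_form ::
  "('a, 'e::euclidean_space) atlas \<Rightarrow> ('b, 'f::euclidean_space) atlas \<Rightarrow> ('a \<Rightarrow> 'b)
    \<Rightarrow> ('b \<Rightarrow> ('b, 'f) tvec \<Rightarrow> 'g) \<Rightarrow> 'a \<Rightarrow> ('a, 'e) tvec \<Rightarrow> 'g"
  where "pullback_form A B F \<omega> p v = \<omega> (F p) (tangent_map A B F p v)"

definition pullback_two_form ::
  "('a, 'e::euclidean_space) atlas \<Rightarrow> ('b, 'f::euclidean_space) atlas \<Rightarrow> ('a \<Rightarrow> 'b)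
    \<Rightarrow> ('b \<Rightarrow> ('b, 'f) tvec \<Rightarrow> ('b, 'f) tvec \<Rightarrow> real) \<Rightarrow> 'a \<Rightarrow> ('a, 'e) tvec \<Rightarrow> ('a, 'e) tvec \<Rightarrow> real"
  where "pullback_two_form A B F \<omega> p u v =
    \<omega> (F p) (tangent_map A B F p u) (tangent_map A B F p v)"

text \<open>With \<open>\<omega> = \<Sum>\<^sub>i \<omega>\<^sub>i dx\<^sup>i\<close> in a chart,
  \<open>d\<omega>(u,v) = \<Sum>\<^sub>i\<^sub>j \<partial>\<^sub>j \<omega>\<^sub>i (u\<^sup>j v\<^sup>i - v\<^sup>j u\<^sup>i)\<close>.\<close>

definition ext_deriv ::
  "('a, 'e::euclidean_space) atlas \<Rightarrow> ('a \<Rightarrow> ('a, 'e) tvec \<Rightarrow> real)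
    \<Rightarrow> 'a \<Rightarrow> ('a, 'e) tvec \<Rightarrow> ('a, 'e) tvec \<Rightarrow> real"
  where "ext_deriv A \<omega> p u v = (let c = chart_at A p;
      w = (\<lambda>e x. \<omega> (cinv c x) (coord_vec A c (cinv c x) e)) in
    frechet_derivative (w (v c)) (at (snd c p)) (u c) -
    frechet_derivative (w (u c)) (at (snd c p)) (v c))"

definition riemannian_metric ::
  "('a, 'e::euclidean_space) atlas \<Rightarrow> ('a \<Rightarrow> ('a, 'e) tvec \<Rightarrow> ('a, 'e) tvec \<Rightarrow> real) \<Rightarrow> bool"
  where "riemannian_metric A g \<longleftrightarrow>
    (\<forall>p\<in>points A. \<forall>u\<in>tangent_space A p.
       linear_on_sub (tangent_space A p) (g p u) \<and>
       (\<forall>v\<in>tangent_space A p. g p u v = g p v u) \<and> (u \<noteq> 0 \<longrightarrow> g p u u > 0)) \<and>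
    (\<forall>c\<in>A. \<forall>e e'. smooth_on (snd c ` fst c)
       (\<lambda>x. g (cinv c x) (coord_vec A c (cinv c x) e) (coord_vec A c (cinv c x) e')))"

text \<open>A bivector at \<open>p\<close> is an alternating bilinear form on the cotangent space at \<open>p\<close>.\<close>

definition bivector_field ::
  "('a, 'e::euclidean_space) atlas \<Rightarrow> ('a \<Rightarrow> ('a, 'e) covec \<Rightarrow> ('a, 'e) covec \<Rightarrow> real) \<Rightarrow> bool"
  where "bivector_field A \<pi> \<longleftrightarrow>
    (\<forall>p\<in>points A. \<forall>\<alpha>\<in>cotangent_space A p.
       linear_on_sub (cotangent_space A p) (\<pi> p \<alpha>) \<and>
       (\<forall>\<beta>\<in>cotangent_space A p. \<pi> p \<alpha> \<beta> = - \<pi> p \<beta> \<alpha>)) \<and>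
    (\<forall>c\<in>A. \<forall>b\<in>Basis. \<forall>b'\<in>Basis. smooth_on (snd c ` fst c)
       (\<lambda>x. \<pi> (cinv c x) (coord_covec A c (cinv c x) b) (coord_covec A c (cinv c x) b')))"

definition sharp ::
  "('a, 'e::euclidean_space) atlas \<Rightarrow> ('a \<Rightarrow> ('a, 'e) covec \<Rightarrow> ('a, 'e) covec \<Rightarrow> real)
    \<Rightarrow> 'a \<Rightarrow> ('a, 'e) covec \<Rightarrow> ('a, 'e) tvec"
  where "sharp A \<pi> p \<alpha> =
    (THE X. X \<in> tangent_space A p \<and> (\<forall>\<beta>\<in>cotangent_space A p. \<beta> X = \<pi> p \<alpha> \<beta>))"

definition bracket ::
  "('a, 'e::euclidean_space) atlas \<Rightarrow> ('a \<Rightarrow> ('a, 'e) covec \<Rightarrow> ('a, 'e) covec \<Rightarrow> real)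
    \<Rightarrow> ('a \<Rightarrow> real) \<Rightarrow> ('a \<Rightarrow> real) \<Rightarrow> 'a \<Rightarrow> real"
  where "bracket A \<pi> f g p = \<pi> p (differential A f p) (differential A g p)"


section \<open>Almost Dirac structures\<close>

definition dirac_pairing ::
  "('a, 'e) tvec \<times> ('a, 'e) covec \<Rightarrow> ('a, 'e) tvec \<times> ('a, 'e) covec \<Rightarrow> real"
  where "dirac_pairing x y = snd x (fst y) + snd y (fst x)"

definition isotropic_subspace ::
  "('a, 'e::euclidean_space) atlas \<Rightarrow> 'a \<Rightarrow> (('a, 'e) tvec \<times> ('a, 'e) covec) set \<Rightarrow> bool"
  where "isotropic_subspace A p K \<longleftrightarrow>
    subspace K \<and> K \<subseteq> tangent_space A p \<times> cotangent_space A p \<and>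
    (\<forall>x\<in>K. \<forall>y\<in>K. dirac_pairing x y = 0)"

definition smooth_section ::
  "('a, 'e::euclidean_space) atlas \<Rightarrow> 'a set \<Rightarrow> ('a \<Rightarrow> ('a, 'e) tvec \<times> ('a, 'e) covec) \<Rightarrow> bool"
  where "smooth_section A W s \<longleftrightarrow>
    (\<forall>p\<in>W. s p \<in> tangent_space A p \<times> cotangent_space A p) \<and>
    (\<forall>c\<in>A. smooth_on (snd c ` (fst c \<inter> W)) (\<lambda>x. fst (s (cinv c x)) c) \<and>
       (\<forall>e. smooth_on (snd c ` (fst c \<inter> W))
         (\<lambda>x. snd (s (cinv c x)) (coord_vec A c (cinv c x) e))))"

text \<open>Smooth subbundles (of constant rank \<open>r\<close>) of \<open>TM \<oplus> T\<^sup>*M\<close>, by smooth local frames.\<close>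

definition subbundle ::
  "('a, 'e::euclidean_space) atlas \<Rightarrow> ('a \<Rightarrow> (('a, 'e) tvec \<times> ('a, 'e) covec) set) \<Rightarrow> bool"
  where "subbundle A L \<longleftrightarrow>
    (\<exists>r. \<forall>p\<in>points A. \<exists>W s. openin (mtop A) W \<and> p \<in> W \<and>
       (\<forall>i<r. smooth_section A W (s i)) \<and>
       (\<forall>x\<in>W. L x = span ((\<lambda>i. s i x) ` {..<r}) \<and> dim (L x) = r))"

definition almost_dirac ::
  "('a, 'e::euclidean_space) atlas \<Rightarrow> ('a \<Rightarrow> (('a, 'e) tvec \<times> ('a, 'e) covec) set) \<Rightarrow> bool"
  where "almost_dirac A L \<longleftrightarrow> subbundle A L \<and>
    (\<forall>p\<in>points A. isotropic_subspace A p (L p) \<and>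
       (\<forall>K. isotropic_subspace A p K \<and> L p \<subseteq> K \<longrightarrow> K = L p))"

definition bivector_graph ::
  "('a, 'e::euclidean_space) atlas \<Rightarrow> ('a \<Rightarrow> ('a, 'e) covec \<Rightarrow> ('a, 'e) covec \<Rightarrow> real)
    \<Rightarrow> 'a \<Rightarrow> (('a, 'e) tvec \<times> ('a, 'e) covec) set"
  where "bivector_graph A \<pi> p = {(sharp A \<pi> p \<alpha>, \<alpha>) |\<alpha>. \<alpha> \<in> cotangent_space A p}"


section \<open>The cotangent bundle\<close>

type_synonym ('q, 'e) cot = "'q \<times> ('q, 'e) covec"

text \<open>The chart \<open>(q\<^sup>i, p\<^sub>i)\<close> of the cotangent bundle induced by a chart \<open>(q\<^sup>i)\<close> of the base.\<close>

definition cotangent_chart ::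
  "('q, 'e::euclidean_space) atlas \<Rightarrow> ('q, 'e) chart \<Rightarrow> (('q, 'e) cot, 'e \<times> 'e) chart"
  where "cotangent_chart A c =
    ({(q, \<alpha>). q \<in> fst c \<and> \<alpha> \<in> cotangent_space A q},
     \<lambda>(q, \<alpha>). (snd c q, \<Sum>b\<in>Basis. \<alpha> (coord_vec A c q b) *\<^sub>R b))"

definition cotangent_atlas ::
  "('q, 'e::euclidean_space) atlas \<Rightarrow> (('q, 'e) cot, 'e \<times> 'e) atlas"
  where "cotangent_atlas A = cotangent_chart A ` A"

definition liouville_form ::
  "('q, 'e::euclidean_space) atlas \<Rightarrow> ('q, 'e) cot \<Rightarrow> (('q, 'e) cot, 'e \<times> 'e) tvec \<Rightarrow> real"
  where "liouville_form A m v = snd m (tangent_map (cotangent_atlas A) A fst m v)"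

definition Omega_Q ::
  "('q, 'e::euclidean_space) atlas \<Rightarrow> ('q, 'e) cot
    \<Rightarrow> (('q, 'e) cot, 'e \<times> 'e) tvec \<Rightarrow> (('q, 'e) cot, 'e \<times> 'e) tvec \<Rightarrow> real"
  where "Omega_Q A m u v = - ext_deriv (cotangent_atlas A) (liouville_form A) m u v"

definition sympl_orthogonal ::
  "('q, 'e::euclidean_space) atlas \<Rightarrow> ('q, 'e) cot
    \<Rightarrow> (('q, 'e) cot, 'e \<times> 'e) tvec set \<Rightarrow> (('q, 'e) cot, 'e \<times> 'e) tvec set"
  where "sympl_orthogonal A m W =
    {v \<in> tangent_space (cotangent_atlas A) m. \<forall>w\<in>W. Omega_Q A m v w = 0}"

definition ham_vec ::
  "('q, 'e::euclidean_space) atlas \<Rightarrow> (('q, 'e) cot \<Rightarrow> real)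
    \<Rightarrow> ('q, 'e) cot \<Rightarrow> (('q, 'e) cot, 'e \<times> 'e) tvec"
  where "ham_vec A f m =
    (THE Y. Y \<in> tangent_space (cotangent_atlas A) m \<and>
       (\<forall>w\<in>tangent_space (cotangent_atlas A) m.
          Omega_Q A m Y w = differential (cotangent_atlas A) f m w))"


section \<open>Nonholonomic systems\<close>

definition constraint_dist ::
  "('q, 'e::euclidean_space) atlas \<Rightarrow> ('q \<Rightarrow> ('q, 'e) tvec \<Rightarrow> real ^ 'k) \<Rightarrow> 'q \<Rightarrow> ('q, 'e) tvec set"
  where "constraint_dist A \<epsilon> q = {v \<in> tangent_space A q. \<epsilon> q v = 0}"

text \<open>For \<open>\<epsilon>\<close> of rank \<open>k\<close>, the distribution \<open>ker \<epsilon>\<close> is integrable if every point has a neighbourhood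
  on which it is the tangent distribution of the foliation by the level sets of a submersion
  to \<open>\<real>\<^sup>k\<close>.\<close>

definition integrable_kernel ::
  "('q, 'e::euclidean_space) atlas \<Rightarrow> ('q \<Rightarrow> ('q, 'e) tvec \<Rightarrow> real ^ 'k) \<Rightarrow> bool"
  where "integrable_kernel A \<epsilon> \<longleftrightarrow>
    (\<forall>q\<in>points A. \<exists>W f. openin (mtop A) W \<and> q \<in> W \<and> smooth_fun A W (f :: 'q \<Rightarrow> real ^ 'k) \<and>
       (\<forall>x\<in>W. constraint_dist A \<epsilon> x = {v \<in> tangent_space A x. differential A f x v = 0}))"

definition nonholonomic_system ::
  "('q, 'e::euclidean_space) atlas \<Rightarrow> ('q \<Rightarrow> ('q, 'e) tvec \<Rightarrow> ('q, 'e) tvec \<Rightarrow> real)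
    \<Rightarrow> ('q \<Rightarrow> real) \<Rightarrow> ('q \<Rightarrow> ('q, 'e) tvec \<Rightarrow> real ^ 'k) \<Rightarrow> bool"
  where "nonholonomic_system A g V \<epsilon> \<longleftrightarrow>
    smooth_manifold A \<and> riemannian_metric A g \<and> smooth_fun A (points A) V \<and>
    smooth_one_form A \<epsilon> \<and> (\<forall>q\<in>points A. dim (\<epsilon> q ` tangent_space A q) = CARD('k)) \<and>
    CARD('k) < DIM('e) \<and> \<not> integrable_kernel A \<epsilon>"

definition lagrangian ::
  "('q \<Rightarrow> ('q, 'e) tvec \<Rightarrow> ('q, 'e) tvec \<Rightarrow> real) \<Rightarrow> ('q \<Rightarrow> real) \<Rightarrow> 'q \<Rightarrow> ('q, 'e) tvec \<Rightarrow> real"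
  where "lagrangian g V q v = 1 / 2 * g q v v - V q"

text \<open>The Legendre transform is the fibre derivative.\<close>

definition legendre ::
  "('q, 'e::euclidean_space) atlas \<Rightarrow> ('q \<Rightarrow> ('q, 'e) tvec \<Rightarrow> real)
    \<Rightarrow> 'q \<times> ('q, 'e) tvec \<Rightarrow> ('q, 'e) cot"
  where "legendre A L = (\<lambda>(q, v). (q, \<lambda>w. if w \<in> tangent_space A q
    then deriv (\<lambda>t. L q (v + t *\<^sub>R w)) 0 else 0))"

definition constraint_submanifold ::
  "('q, 'e::euclidean_space) atlas \<Rightarrow> ('q \<Rightarrow> ('q, 'e) tvec \<Rightarrow> ('q, 'e) tvec \<Rightarrow> real)
    \<Rightarrow> ('q \<Rightarrow> real) \<Rightarrow> ('q \<Rightarrow> ('q, 'e) tvec \<Rightarrow> real ^ 'k) \<Rightarrow> ('q, 'e) cot set"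
  where "constraint_submanifold A g V \<epsilon> =
    legendre A (lagrangian g V) ` (SIGMA q:points A. constraint_dist A \<epsilon> q)"

definition F_dist ::
  "('q, 'e::euclidean_space) atlas \<Rightarrow> ('q \<Rightarrow> ('q, 'e) tvec \<Rightarrow> real ^ 'k)
    \<Rightarrow> ('q, 'e) cot \<Rightarrow> (('q, 'e) cot, 'e \<times> 'e) tvec set"
  where "F_dist A \<epsilon> m = {v \<in> tangent_space (cotangent_atlas A) m.
    pullback_form (cotangent_atlas A) A fst \<epsilon> m v = 0}"

text \<open>In the following, \<open>B\<close> is the atlas of the submanifold \<open>M\<close> of \<open>T\<^sup>*Q\<close>, and the tangent map of the
  inclusion identifies the tangent spaces of \<open>M\<close> with subspaces of those of \<open>T\<^sup>*Q\<close>.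
  \<open>C_dist\<close> is the distribution as a subspace of \<open>TM\<close>, \<open>C_amb\<close> its image in \<open>T(T\<^sup>*Q)\<close>.\<close>

definition incl_map ::
  "('q, 'e::euclidean_space) atlas \<Rightarrow> (('q, 'e) cot, 'm::euclidean_space) atlas
    \<Rightarrow> ('q, 'e) cot \<Rightarrow> (('q, 'e) cot, 'm) tvec \<Rightarrow> (('q, 'e) cot, 'e \<times> 'e) tvec"
  where "incl_map A B = tangent_map B (cotangent_atlas A) (\<lambda>x. x)"

definition C_dist ::
  "('q, 'e::euclidean_space) atlas \<Rightarrow> (('q, 'e) cot, 'm::euclidean_space) atlas
    \<Rightarrow> ('q \<Rightarrow> ('q, 'e) tvec \<Rightarrow> real ^ 'k) \<Rightarrow> ('q, 'e) cot \<Rightarrow> (('q, 'e) cot, 'm) tvec set"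
  where "C_dist A B \<epsilon> m = {X \<in> tangent_space B m. incl_map A B m X \<in> F_dist A \<epsilon> m}"

definition C_amb ::
  "('q, 'e::euclidean_space) atlas \<Rightarrow> (('q, 'e) cot, 'm::euclidean_space) atlas
    \<Rightarrow> ('q \<Rightarrow> ('q, 'e) tvec \<Rightarrow> real ^ 'k) \<Rightarrow> ('q, 'e) cot \<Rightarrow> (('q, 'e) cot, 'e \<times> 'e) tvec set"
  where "C_amb A B \<epsilon> m = incl_map A B m ` tangent_space B m \<inter> F_dist A \<epsilon> m"

definition Omega_M ::
  "('q, 'e::euclidean_space) atlas \<Rightarrow> (('q, 'e) cot, 'm::euclidean_space) atlas
    \<Rightarrow> ('q, 'e) cot \<Rightarrow> (('q, 'e) cot, 'm) tvec \<Rightarrow> (('q, 'e) cot, 'm) tvec \<Rightarrow> real"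
  where "Omega_M A B = pullback_two_form B (cotangent_atlas A) (\<lambda>x. x) (Omega_Q A)"

definition Omega_C ::
  "('q, 'e::euclidean_space) atlas \<Rightarrow> (('q, 'e) cot, 'm::euclidean_space) atlas
    \<Rightarrow> ('q \<Rightarrow> ('q, 'e) tvec \<Rightarrow> real ^ 'k)
    \<Rightarrow> ('q, 'e) cot \<Rightarrow> (('q, 'e) cot, 'm) tvec \<Rightarrow> (('q, 'e) cot, 'm) tvec \<Rightarrow> real"
  where "Omega_C A B \<epsilon> m X Y =
    (if X \<in> C_dist A B \<epsilon> m \<and> Y \<in> C_dist A B \<epsilon> m then Omega_M A B m X Y else 0)"

definition C_projector ::
  "('q, 'e::euclidean_space) atlas \<Rightarrow> (('q, 'e) cot, 'm::euclidean_space) atlas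
    \<Rightarrow> ('q \<Rightarrow> ('q, 'e) tvec \<Rightarrow> real ^ 'k)
    \<Rightarrow> ('q, 'e) cot \<Rightarrow> (('q, 'e) cot, 'e \<times> 'e) tvec \<Rightarrow> (('q, 'e) cot, 'e \<times> 'e) tvec"
  where "C_projector A B \<epsilon> m v =
    (THE u. u \<in> C_amb A B \<epsilon> m \<and> v - u \<in> sympl_orthogonal A m (C_amb A B \<epsilon> m))"

text \<open>The defining property of the nonholonomic bivector field \<open>\<pi>\<close>: \<open>\<pi>\<^sup>#(\<alpha>) = - X\<close> iff
  \<open>i\<^sub>X \<Omega>\<^sub>C\<close> is the restriction of \<open>\<alpha>\<close> to \<open>C\<close>.  Since all objects are tensorial, this is
  stated at each point.\<close>

definition is_pi_nh ::
  "('q, 'e::euclidean_space) atlas \<Rightarrow> (('q, 'e) cot, 'm::euclidean_space) atlas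
    \<Rightarrow> ('q \<Rightarrow> ('q, 'e) tvec \<Rightarrow> real ^ 'k)
    \<Rightarrow> (('q, 'e) cot \<Rightarrow> (('q, 'e) cot, 'm) covec \<Rightarrow> (('q, 'e) cot, 'm) covec \<Rightarrow> real) \<Rightarrow> bool"
  where "is_pi_nh A B \<epsilon> \<pi> \<longleftrightarrow> bivector_field B \<pi> \<and>
    (\<forall>m\<in>points B. \<forall>\<alpha>\<in>cotangent_space B m. \<forall>X\<in>C_dist A B \<epsilon> m.
       sharp B \<pi> m \<alpha> = - X \<longleftrightarrow> (\<forall>Y\<in>C_dist A B \<epsilon> m. Omega_C A B \<epsilon> m X Y = \<alpha> Y))"

definition L_nh ::
  "('q, 'e::euclidean_space) atlas \<Rightarrow> (('q, 'e) cot, 'm::euclidean_space) atlas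
    \<Rightarrow> ('q \<Rightarrow> ('q, 'e) tvec \<Rightarrow> real ^ 'k)
    \<Rightarrow> ('q, 'e) cot \<Rightarrow> ((('q, 'e) cot, 'm) tvec \<times> (('q, 'e) cot, 'm) covec) set"
  where "L_nh A B \<epsilon> m = {(X, \<alpha>). X \<in> tangent_space B m \<and> \<alpha> \<in> cotangent_space B m \<and>
    X \<in> C_dist A B \<epsilon> m \<and> (\<forall>Y\<in>C_dist A B \<epsilon> m. Omega_M A B m X Y = - \<alpha> Y)}"

end

theory Submission
  imports Defs
begin

text \<open>
  The defining property of \<open>\<pi>\<close> at \<open>\<alpha> = 0\<close> says that \<open>\<Omega>\<^sub>C\<close> is nondegenerate, and at
  \<open>X = 0\<close> that \<open>\<pi>\<^sup>#\<close> kills the annihilator of \<open>C\<close>.  As \<open>\<pi>\<close> is skew, the image of \<open>\<pi>\<^sup>#\<close> is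
  therefore contained in \<open>C\<close>, so that \<open>\<pi>\<^sup>#(\<alpha>)\<close> is the unique \<open>X \<in> C\<close> with
  \<open>i\<^sub>X \<Omega>\<^sub>C = - \<alpha>|\<^sub>C\<close>; hence the graph is \<open>L\<^sub>n\<^sub>h\<close>.  The graph of any bivector field is an almost
  Dirac structure, with the sections \<open>(\<pi>\<^sup>#(dx\<^sup>b), dx\<^sup>b)\<close> as local frame.  For the bracket, \<open>Y\<close>
  defined by \<open>i\<^sub>Y \<Omega>\<^sub>Q = df\<close> satisfies \<open>\<Omega>\<^sub>Q(Y, w) = \<Omega>\<^sub>Q(P Y, w)\<close> for \<open>w \<in> C\<close>, so its projection
  \<open>P Y\<close> is \<open>- \<pi>\<^sup>#(df)\<close>, and \<open>\<Omega>\<^sub>Q(\<pi>\<^sup>#(df), \<pi>\<^sup>#(dg)) = - df(\<pi>\<^sup>#(dg)) = \<pi>(df, dg)\<close>.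
\<close>

section \<open>Smooth functions\<close>

text \<open>Openness of \<open>S\<close> is what makes this true: the Frechet derivative at a point
  of \<open>S\<close> sees only values near that point. The induction is over arbitrary
  \<open>f\<close> and \<open>g\<close> because its step passes to derivatives.\<close>

lemma Ck_on_cong:
  fixes f g :: "'e::euclidean_space \<Rightarrow> 'f::real_normed_vector"
  assumes "open S" "\<And>x. x \<in> S \<Longrightarrow> f x = g x" "Ck_on k S f"
  shows "Ck_on k S g"
  using assms(2,3)
proof (induction k arbitrary: f g)
  case 0
  then show ?case by (simp cong: continuous_on_cong)
next
  case (Suc k)
  have diff: "f differentiable at x" if "x \<in> S" for x
    using Suc.prems(2) that assms(1) by (simp add: differentiable_on_eq_differentiable_at)
  have "frechet_derivative f (at x) = frechet_derivative g (at x)" if "x \<in> S" for x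
    using frechet_derivative_transform_within_open[OF diff[OF that] assms(1) that] Suc.prems(1)
    by blast
  then have "Ck_on k S (\<lambda>x. frechet_derivative g (at x) v)" for v
    using Suc.IH[of "\<lambda>x. frechet_derivative f (at x) v" "\<lambda>x. frechet_derivative g (at x) v"]
      Suc.prems(2) by simp
  moreover have "g differentiable at x" if "x \<in> S" for x
    using diff[OF that] Suc.prems(1) assms(1) that
    by (meson differentiable_def has_derivative_transform_within_open)
  ultimately show ?case
    using assms(1) by (simp add: differentiable_on_eq_differentiable_at)
qed

lemma Ck_on_Suc_imp:
  "Ck_on (Suc k) S f \<Longrightarrow> Ck_on k S f"
proof (induction k arbitrary: f)
  case 0
  then show ?case by (simp add: differentiable_imp_continuous_on)
next
  case (Suc k)
  have "Ck_on k S (\<lambda>x. frechet_derivative f (at x) v)" for v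
    using Suc.IH[of "\<lambda>x. frechet_derivative f (at x) v"] Suc.prems by simp
  then show ?case using Suc.prems by simp
qed

lemma Ck_on_const:
  "Ck_on k S (\<lambda>x. c)"
  by (induction k arbitrary: c) simp_all

lemma Ck_on_add:
  fixes f g :: "'e::euclidean_space \<Rightarrow> 'f::real_normed_vector"
  assumes "open S" "Ck_on k S f" "Ck_on k S g"
  shows "Ck_on k S (\<lambda>x. f x + g x)"
  using assms(2,3)
proof (induction k arbitrary: f g)
  case 0
  then show ?case by (simp add: continuous_on_add)
next
  case (Suc k)
  have D: "((\<lambda>x. f x + g x) has_derivative
      (\<lambda>v. frechet_derivative f (at x) v + frechet_derivative g (at x) v)) (at x)"
    if "x \<in> S" for x
    using Suc.prems that assms(1)
    by (auto simp: differentiable_on_eq_differentiable_at frechet_derivative_works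
        intro!: has_derivative_add)
  have "Ck_on k S (\<lambda>x. frechet_derivative f (at x) v + frechet_derivative g (at x) v)" for v
    using Suc by simp
  then have "Ck_on k S (\<lambda>x. frechet_derivative (\<lambda>x. f x + g x) (at x) v)" for v
    by (rule Ck_on_cong[OF assms(1), rotated]) (simp add: frechet_derivative_at[OF D, symmetric])
  then show ?case
    using Suc.prems by (simp add: differentiable_on_add)
qed

lemma (in bounded_bilinear) Ck_on:
  fixes f :: "'e::euclidean_space \<Rightarrow> 'a" and g :: "'e \<Rightarrow> 'b"
  assumes "open S" "Ck_on k S f" "Ck_on k S g"
  shows "Ck_on k S (\<lambda>x. f x ** g x)"
  using assms(2,3)
proof (induction k arbitrary: f g)
  case 0
  then show ?case by (simp add: continuous_on)
next
  case (Suc k)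
  have D: "((\<lambda>x. f x ** g x) has_derivative
      (\<lambda>v. f x ** frechet_derivative g (at x) v + frechet_derivative f (at x) v ** g x)) (at x)"
    if "x \<in> S" for x
    using Suc.prems that assms(1)
    by (auto simp: differentiable_on_eq_differentiable_at frechet_derivative_works intro!: FDERIV)
  \<comment> \<open>The product rule leaves one factor undifferentiated in each summand. That factor
    has order \<open>Suc k\<close> and is lowered to order \<open>k\<close> before the induction
    hypothesis is applied.\<close>
  have "Ck_on k S (\<lambda>x. f x ** frechet_derivative g (at x) v + frechet_derivative f (at x) v ** g x)"
    for v
    using Suc Ck_on_Suc_imp[OF Suc.prems(1)] Ck_on_Suc_imp[OF Suc.prems(2)]
    by (intro Ck_on_add[OF assms(1)] Suc.IH) auto
  then have "Ck_on k S (\<lambda>x. frechet_derivative (\<lambda>x. f x ** g x) (at x) v)" for v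
    by (rule Ck_on_cong[OF assms(1), rotated]) (simp add: frechet_derivative_at[OF D, symmetric])
  moreover have "(\<lambda>x. f x ** g x) differentiable_on S"
    using D assms(1) by (auto simp: differentiable_on_eq_differentiable_at differentiable_def)
  ultimately show ?case by simp
qed

lemma smooth_on_cong:
  fixes f g :: "'e::euclidean_space \<Rightarrow> 'f::real_normed_vector"
  assumes "open S" "smooth_on S f" "\<And>x. x \<in> S \<Longrightarrow> f x = g x"
  shows "smooth_on S g"
  using assms Ck_on_cong unfolding smooth_on_def by blast

lemma smooth_on_const:
  "smooth_on S (\<lambda>x. c)"
  by (simp add: smooth_on_def Ck_on_const)

lemma smooth_on_sum:
  fixes f :: "'i \<Rightarrow> 'e::euclidean_space \<Rightarrow> 'f::real_normed_vector"
  assumes "open S" "\<And>i. i \<in> I \<Longrightarrow> smooth_on S (f i)"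
  shows "smooth_on S (\<lambda>x. \<Sum>i\<in>I. f i x)"
proof (cases "finite I")
  case True
  then show ?thesis
    using assms(2)
    by (induction I rule: finite_induct)
      (auto simp: smooth_on_def Ck_on_const intro!: Ck_on_add[OF assms(1)])
next
  case False
  then show ?thesis by (simp add: smooth_on_const)
qed

lemma (in bounded_bilinear) smooth_on:
  fixes f :: "'e::euclidean_space \<Rightarrow> 'a" and g :: "'e \<Rightarrow> 'b"
  assumes "open S" "smooth_on S f" "smooth_on S g"
  shows "smooth_on S (\<lambda>x. f x ** g x)"
  using assms by (simp add: smooth_on_def Ck_on)

lemmas smooth_on_inner = bounded_bilinear.smooth_on[OF bounded_bilinear_inner]
lemmas smooth_on_scaleR = bounded_bilinear.smooth_on[OF bounded_bilinear_scaleR]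

lemma smooth_on_frechet_derivative:
  "smooth_on S f \<Longrightarrow> smooth_on S (\<lambda>x. frechet_derivative f (at x) v)"
  using Ck_on.simps(2) unfolding smooth_on_def by blast

lemma smooth_on_imp_differentiable:
  assumes "smooth_on S f" "open S" "x \<in> S"
  shows "f differentiable (at x)"
  using assms Ck_on.simps(2) unfolding smooth_on_def
  by (metis differentiable_on_eq_differentiable_at)

lemma smooth_on_subset:
  assumes "smooth_on T f" "S \<subseteq> T"
  shows "smooth_on S f"
proof -
  have "Ck_on k S f" if "Ck_on k T f" for k and f :: "'a \<Rightarrow> 'b"
    using that
  proof (induction k arbitrary: f)
    case 0
    then show ?case using assms(2) by (auto intro: continuous_on_subset)
  next
    case (Suc k)
    then show ?case using assms(2) by (auto intro: differentiable_on_subset)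
  qed
  then show ?thesis using assms(1) by (simp add: smooth_on_def)
qed


section \<open>Function spaces\<close>

lemma scaleR_fun_apply [simp]: "(r *\<^sub>R f) x = r *\<^sub>R f x"
  by (simp add: scaleR_fun_def)

lemma sum_fun_apply [simp]: "(\<Sum>i\<in>I. f i) x = (\<Sum>i\<in>I. f i x)"
  by (induction I rule: infinite_finite_induct) simp_all

lemma linear_on_subD:
  assumes "linear_on_sub V f"
  shows linear_on_sub_add: "x \<in> V \<Longrightarrow> y \<in> V \<Longrightarrow> f (x + y) = f x + f y"
    and linear_on_sub_scaleR: "x \<in> V \<Longrightarrow> f (r *\<^sub>R x) = r *\<^sub>R f x"
  using assms unfolding linear_on_sub_def by blast+

text \<open>Covectors are linear on a tangent space only. Composed with a linear parametrisation of
  that space they become linear on a whole vector space, so that rules such as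
  \<open>linear_sum\<close> apply.\<close>

lemma linear_on_sub_compose_linear:
  assumes "linear_on_sub V f" "linear h" "\<And>x. h x \<in> V"
  shows "linear (\<lambda>x. f (h x))"
  using assms linear_on_subD[OF assms(1)] by (auto intro!: linearI simp: linear_add linear_scale)

lemma linear_on_sub_diff:
  assumes "linear_on_sub V f" "subspace V" "x \<in> V" "y \<in> V"
  shows "f (x - y) = f x - f y"
proof -
  have "f (x - y) + f y = f x"
    using linear_on_sub_add[OF assms(1) subspace_diff[OF assms(2-4)] assms(4)] by simp
  then show ?thesis by (simp add: algebra_simps)
qed

lemma linear_on_sub_minus:
  assumes "linear_on_sub V f" "x \<in> V"
  shows "f (- x) = - f x"
  using linear_on_sub_scaleR[OF assms, of "-1"] by simp


section \<open>Tangent and cotangent spaces in charts\<close>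

abbreviation transition_deriv ::
  "('a, 'e::euclidean_space) chart \<Rightarrow> ('a, 'e) chart \<Rightarrow> 'a \<Rightarrow> 'e \<Rightarrow> 'e"
  where "transition_deriv c d p \<equiv> frechet_derivative (snd d \<circ> cinv c) (at (snd c p))"

text \<open>The linear algebra of tangent spaces only needs differentiable coordinate changes; this
  spares the proof that the cotangent bundle is a smooth manifold.\<close>

locale C1_atlas =
  fixes A :: "('a, 'e::euclidean_space) atlas"
  assumes inj_chart: "c \<in> A \<Longrightarrow> inj_on (snd c) (fst c)"
    and open_chart_image: "c \<in> A \<Longrightarrow> open (snd c ` fst c)"
    and open_overlap: "c \<in> A \<Longrightarrow> d \<in> A \<Longrightarrow> open (snd c ` (fst c \<inter> fst d))"
    and differentiable_transition: "c \<in> A \<Longrightarrow> d \<in> A \<Longrightarrow> x \<in> snd c ` (fst c \<inter> fst d)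
      \<Longrightarrow> (snd d \<circ> cinv c) differentiable (at x)"
begin

section \<open>Charts and their inverses\<close>

lemma chart_atD:
  assumes "c \<in> charts_at A p"
  shows "c \<in> A" "p \<in> fst c" "p \<in> points A"
  using assms by (auto simp: charts_at_def points_def)

lemma charts_atI: "c \<in> A \<Longrightarrow> p \<in> fst c \<Longrightarrow> c \<in> charts_at A p"
  by (simp add: charts_at_def)

lemma chart_at_in: "p \<in> points A \<Longrightarrow> chart_at A p \<in> charts_at A p"
  unfolding chart_at_def points_def charts_at_def by (rule someI_ex) blast

lemma cinv_chart: "c \<in> A \<Longrightarrow> p \<in> fst c \<Longrightarrow> cinv c (snd c p) = p"
  by (simp add: cinv_def inj_chart)

lemma chart_cinv:
  assumes "c \<in> A" "x \<in> snd c ` W" "W \<subseteq> fst c"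
  shows "snd c (cinv c x) = x" "cinv c x \<in> W"
  using assms inj_chart[OF assms(1)] by (auto simp: cinv_def inv_into_f_f subset_iff)

text \<open>Images commute with intersections because a chart is injective; this is the intersection
  axiom for \<open>mtop\<close>.\<close>

lemma open_image_inter:
  assumes "c \<in> A" "open (snd c ` (fst c \<inter> W))" "open (snd c ` (fst c \<inter> W'))"
  shows "open (snd c ` (fst c \<inter> (W \<inter> W')))"
proof -
  have "snd c ` (fst c \<inter> (W \<inter> W')) = snd c ` (fst c \<inter> W) \<inter> snd c ` (fst c \<inter> W')"
    using inj_chart[OF assms(1)] by (auto simp: inj_on_def)
  then show ?thesis using open_Int[OF assms(2,3)] by metis
qed

section \<open>Jacobians of coordinate changes\<close>

lemma transition_has_derivative:
  assumes "c \<in> charts_at A p" "d \<in> charts_at A p"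
  shows "((snd d \<circ> cinv c) has_derivative transition_deriv c d p) (at (snd c p))"
  using differentiable_transition[of c d "snd c p"] chart_atD[OF assms(1)] chart_atD[OF assms(2)]
  by (auto simp: frechet_derivative_works)

lemma linear_transition_deriv:
  "c \<in> charts_at A p \<Longrightarrow> d \<in> charts_at A p \<Longrightarrow> linear (transition_deriv c d p)"
  using transition_has_derivative has_derivative_linear by blast

text \<open>Chain rule through the coordinate change. The composite agrees with the map read in
  \<open>c\<close> only on the image of the overlap, which suffices because that image is open
  around the point.\<close>

lemma has_derivative_change_chart:
  assumes "c \<in> charts_at A p" "d \<in> charts_at A p"
    and "((F \<circ> cinv d) has_derivative F') (at (snd d p))"
  shows "((F \<circ> cinv c) has_derivative F' \<circ> transition_deriv c d p) (at (snd c p))"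
proof -
  note c = chart_atD[OF assms(1)] and d = chart_atD[OF assms(2)]
  have "((F \<circ> cinv d) has_derivative F') (at ((snd d \<circ> cinv c) (snd c p)))"
    using assms(3) cinv_chart[OF c(1,2)] by simp
  then have "((F \<circ> cinv d) \<circ> (snd d \<circ> cinv c) has_derivative F' \<circ> transition_deriv c d p)
      (at (snd c p))"
    using transition_has_derivative[OF assms(1,2)] diff_chain_at by blast
  then show ?thesis
  proof (rule has_derivative_transform_within_open[OF _ open_overlap[OF c(1) d(1)]])
    show "snd c p \<in> snd c ` (fst c \<inter> fst d)" using c d by blast
    show "((F \<circ> cinv d) \<circ> (snd d \<circ> cinv c)) x = (F \<circ> cinv c) x"
      if "x \<in> snd c ` (fst c \<inter> fst d)" for x
      using chart_cinv[OF c(1) that] cinv_chart[OF d(1)] by simp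
  qed
qed

text \<open>The preceding change of chart is applied to the coordinate map of \<open>e\<close>;
  uniqueness of derivatives gives the identity.\<close>

lemma transition_deriv_cocycle:
  assumes "c \<in> charts_at A p" "d \<in> charts_at A p" "e \<in> charts_at A p"
  shows "transition_deriv d e p (transition_deriv c d p x) = transition_deriv c e p x"
  using frechet_derivative_at[OF has_derivative_change_chart[OF assms(1,2)
    transition_has_derivative[OF assms(2,3)]]] by (metis comp_apply)

lemma transition_deriv_self:
  assumes "c \<in> charts_at A p"
  shows "transition_deriv c c p x = x"
proof -
  note c = chart_atD[OF assms]
  have "((snd c \<circ> cinv c) has_derivative (\<lambda>x. x)) (at (snd c p))"
    by (rule has_derivative_transform_within_open[OF has_derivative_ident open_chart_image[OF c(1)]])
      (use c chart_cinv[OF c(1)] in auto)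
  then show ?thesis using frechet_derivative_at by metis
qed

section \<open>Tangent spaces parametrised by coordinates\<close>

lemma coord_vec_apply:
  "d \<in> charts_at A p \<Longrightarrow> coord_vec A c p x d = transition_deriv c d p x"
  by (simp add: coord_vec_def)

lemma coord_vec_same [simp]: "c \<in> charts_at A p \<Longrightarrow> coord_vec A c p x c = x"
  by (simp add: coord_vec_apply transition_deriv_self)

lemma coord_vec_in: "c \<in> charts_at A p \<Longrightarrow> coord_vec A c p x \<in> tangent_space A p"
  by (auto simp: tangent_space_def coord_vec_def transition_deriv_cocycle)

text \<open>The compatibility condition expresses every component through the one in
  \<open>c\<close>, and off the charts at \<open>p\<close> both sides have the default value 0.
  Tangent vectors can therefore be compared in a single chart.\<close>

lemma tangent_eq_coord_vec:
  assumes "c \<in> charts_at A p" "v \<in> tangent_space A p"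
  shows "v = coord_vec A c p (v c)"
proof
  fix d
  show "v d = coord_vec A c p (v c) d"
  proof (cases "d \<in> charts_at A p")
    case True
    then have "v d = transition_deriv c d p (v c)"
      using assms unfolding tangent_space_def by blast
    then show ?thesis unfolding coord_vec_apply[OF True] .
  next
    case False
    then have "v d = 0" using assms(2) unfolding tangent_space_def by blast
    then show ?thesis using False by (simp add: coord_vec_def)
  qed
qed

lemma tangent_eqI:
  assumes "c \<in> charts_at A p" "u \<in> tangent_space A p" "v \<in> tangent_space A p" "u c = v c"
  shows "u = v"
  using tangent_eq_coord_vec[OF assms(1,2)] tangent_eq_coord_vec[OF assms(1,3)] assms(4) by metis

lemma linear_coord_vec:
  assumes "c \<in> charts_at A p"
  shows "linear (coord_vec A c p)"
proof (rule linearI)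
  show "coord_vec A c p (x + y) = coord_vec A c p x + coord_vec A c p y" for x y
    using linear_add[OF linear_transition_deriv[OF assms]] by (auto simp: fun_eq_iff coord_vec_def)
  show "coord_vec A c p (r *\<^sub>R x) = r *\<^sub>R coord_vec A c p x" for r x
    using linear_scale[OF linear_transition_deriv[OF assms]] by (auto simp: fun_eq_iff coord_vec_def)
qed

lemma tangent_space_eq_range:
  assumes "c \<in> charts_at A p"
  shows "tangent_space A p = range (coord_vec A c p)"
proof
  show "tangent_space A p \<subseteq> range (coord_vec A c p)"
    using tangent_eq_coord_vec[OF assms] by blast
  show "range (coord_vec A c p) \<subseteq> tangent_space A p"
    using coord_vec_in[OF assms] by blast
qed

lemma subspace_tangent_space: "subspace (tangent_space A p)"
proof (cases "charts_at A p = {}")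
  \<comment> \<open>With no chart at \<open>p\<close>, a tangent vector consists of default values
    only.\<close>
  case True
  then have "tangent_space A p = {0}" by (auto simp: tangent_space_def)
  then show ?thesis by (simp add: subspace_single_0)
next
  case False
  then obtain c where c: "c \<in> charts_at A p" by blast
  show ?thesis
    unfolding tangent_space_eq_range[OF c]
    by (rule linear_subspace_image[OF linear_coord_vec[OF c] subspace_UNIV])
qed

section \<open>Cotangent spaces parametrised by coordinates\<close>

lemma coord_covec_in: "coord_covec A c p z \<in> cotangent_space A p"
  using subspace_add[OF subspace_tangent_space] subspace_scale[OF subspace_tangent_space]
  by (auto simp: cotangent_space_def coord_covec_def linear_on_sub_def inner_add_left)

lemma coord_covec_coord_vec:
  "c \<in> charts_at A p \<Longrightarrow> coord_covec A c p z (coord_vec A c p x) = x \<bullet> z"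
  by (simp add: coord_covec_def coord_vec_in)

lemma linear_coord_covec: "linear (coord_covec A c p)"
  by (rule linearI) (auto simp: coord_covec_def fun_eq_iff inner_add_right)

lemma inj_coord_covec:
  assumes "c \<in> charts_at A p"
  shows "inj (coord_covec A c p)"
proof (rule injI)
  fix z w assume "coord_covec A c p z = coord_covec A c p w"
  then have "x \<bullet> z = x \<bullet> w" for x
    using coord_covec_coord_vec[OF assms] by metis
  then show "z = w" by (rule vector_eq_ldot[THEN iffD1, OF allI])
qed

lemma linear_covector_coords:
  assumes "c \<in> charts_at A p" "\<alpha> \<in> cotangent_space A p"
  shows "linear (\<lambda>x. \<alpha> (coord_vec A c p x))"
  using assms(2) linear_on_sub_compose_linear[OF _ linear_coord_vec[OF assms(1)]
    coord_vec_in[OF assms(1)]] unfolding cotangent_space_def by blast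

text \<open>For a general vector \<open>z\<close>, \<open>coord_covec A c p z\<close> is the
  combination of the coordinate covectors with coefficients \<open>z\<close>. The coefficients of
  \<alpha> are its values on the coordinate vectors, found by expanding the coordinates of a tangent
  vector in the orthonormal basis.\<close>

lemma cotangent_eq_coord_covec:
  assumes "c \<in> charts_at A p" "\<alpha> \<in> cotangent_space A p"
  shows "\<alpha> = coord_covec A c p (\<Sum>b\<in>Basis. \<alpha> (coord_vec A c p b) *\<^sub>R b)"
proof
  fix v
  show "\<alpha> v = coord_covec A c p (\<Sum>b\<in>Basis. \<alpha> (coord_vec A c p b) *\<^sub>R b) v"
  proof (cases "v \<in> tangent_space A p")
    case True
    have "\<alpha> v = \<alpha> (coord_vec A c p (\<Sum>b\<in>Basis. (v c \<bullet> b) *\<^sub>R b))"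
      using tangent_eq_coord_vec[OF assms(1) True] by (simp add: euclidean_representation)
    also have "\<dots> = (\<Sum>b\<in>Basis. (v c \<bullet> b) * \<alpha> (coord_vec A c p b))"
      by (simp add: linear_sum[OF linear_covector_coords[OF assms]]
        linear_scale[OF linear_covector_coords[OF assms]])
    finally show ?thesis
      using True by (simp add: coord_covec_def inner_sum_right mult.commute)
  next
    case False
    then show ?thesis using assms(2) by (simp add: coord_covec_def cotangent_space_def)
  qed
qed

lemma cotangent_space_eq_range:
  assumes "c \<in> charts_at A p"
  shows "cotangent_space A p = range (coord_covec A c p)"
  using cotangent_eq_coord_covec[OF assms] coord_covec_in by blast

section \<open>Separation by covectors\<close>

lemma covectors_separate:
  assumes "u \<in> tangent_space A p" "v \<in> tangent_space A p"
    and "\<And>\<beta>. \<beta> \<in> cotangent_space A p \<Longrightarrow> \<beta> u = \<beta> v" and "p \<in> points A"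
  shows "u = v"
proof -
  note c = chart_at_in[OF assms(4)]
  have "u (chart_at A p) \<bullet> z = v (chart_at A p) \<bullet> z" for z
    using assms(3)[OF coord_covec_in[of "chart_at A p" p z]] assms(1,2) by (simp add: coord_covec_def)
  then have "u (chart_at A p) = v (chart_at A p)"
    by (rule vector_eq_rdot[THEN iffD1, OF allI])
  then show ?thesis using tangent_eqI[OF c assms(1,2)] by simp
qed

text \<open>The double annihilator of a subspace is the subspace. In coordinates, the component
  \<open>z\<close> of \<open>v\<close> orthogonal to \<open>S\<close> defines a covector that
  annihilates \<open>S\<close>; its value on \<open>v\<close> is the squared norm of
  \<open>z\<close>, so \<open>z\<close> must vanish.\<close>

lemma covector_separates_subspace:
  assumes "subspace S" "S \<subseteq> tangent_space A p" "p \<in> points A" "v \<in> tangent_space A p"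
    and "\<And>\<beta>. \<beta> \<in> cotangent_space A p \<Longrightarrow> (\<And>s. s \<in> S \<Longrightarrow> \<beta> s = 0) \<Longrightarrow> \<beta> v = 0"
  shows "v \<in> S"
proof -
  define c where "c = chart_at A p"
  have c: "c \<in> charts_at A p" using chart_at_in[OF assms(3)] by (simp add: c_def)
  define T where "T = (\<lambda>s. s c) ` S"
  have "linear (\<lambda>s :: ('a, 'e) tvec. s c)" by (rule linearI) simp_all
  then have "subspace T" unfolding T_def using assms(1) by (rule linear_subspace_image)
  obtain y z where yz: "y \<in> span T" "\<And>w. w \<in> span T \<Longrightarrow> orthogonal z w" "v c = y + z"
    using orthogonal_subspace_decomp_exists by metis
  have T: "span T = T" using \<open>subspace T\<close> by (simp add: span_eq_iff)
  have "coord_covec A c p z v = 0"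
  proof (rule assms(5)[OF coord_covec_in])
    fix s assume "s \<in> S"
    then have "orthogonal z (s c)" by (auto simp: T_def intro!: yz(2) span_base)
    then show "coord_covec A c p z s = 0"
      by (simp add: coord_covec_def orthogonal_def inner_commute)
  qed
  then have "(y + z) \<bullet> z = 0" using assms(4) yz(3) by (simp add: coord_covec_def)
  then have "z = 0" using yz(2)[OF yz(1)] by (simp add: orthogonal_def inner_commute inner_add_right)
  then have "v c \<in> T" using yz(1,3) T by simp
  then obtain s where "s \<in> S" "s c = v c" unfolding T_def by (metis imageE)
  then show ?thesis using tangent_eqI[OF c _ assms(4)] assms(2) by blast
qed

lemma subspace_cotangent_space:
  assumes "p \<in> points A"
  shows "subspace (cotangent_space A p)"
  unfolding cotangent_space_eq_range[OF chart_at_in[OF assms]]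
  by (rule linear_subspace_image[OF linear_coord_covec subspace_UNIV])

lemma differential_in_cotangent:
  assumes "p \<in> points A" "(f \<circ> cinv (chart_at A p)) differentiable (at (snd (chart_at A p) p))"
  shows "differential A f p \<in> cotangent_space A p"
proof -
  have "linear (frechet_derivative (f \<circ> cinv (chart_at A p)) (at (snd (chart_at A p) p)))"
    using assms(2) by (simp add: linear_frechet_derivative)
  then show ?thesis
    using subspace_add[OF subspace_tangent_space] subspace_scale[OF subspace_tangent_space]
    by (auto simp: cotangent_space_def differential_def linear_on_sub_def Let_def linear_add
        linear_scale)
qed

lemma smooth_fun_differentiable:
  assumes "smooth_fun A (points A) f" "c \<in> charts_at A p"
  shows "(f \<circ> cinv c) differentiable (at (snd c p))"
proof -
  note c = chart_atD[OF assms(2)]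
  have "fst c \<inter> points A = fst c" using c(1) by (auto simp: points_def)
  then have "smooth_on (snd c ` fst c) (f \<circ> cinv c)"
    using assms(1) c(1) unfolding smooth_fun_def by metis
  then show ?thesis
    using smooth_on_imp_differentiable open_chart_image[OF c(1)] c(2) by blast
qed

end

lemma smooth_manifold_imp_C1_atlas:
  assumes "smooth_manifold A"
  shows "C1_atlas A"
proof
  fix c d and x
  assume "c \<in> A"
  then show "inj_on (snd c) (fst c)" "open (snd c ` fst c)"
    using assms unfolding smooth_manifold_def by blast+
  assume "d \<in> A"
  then show "open (snd c ` (fst c \<inter> fst d))"
    using assms \<open>c \<in> A\<close> unfolding smooth_manifold_def by blast
  moreover have "smooth_on (snd c ` (fst c \<inter> fst d)) (snd d \<circ> cinv c)"
    using assms \<open>c \<in> A\<close> \<open>d \<in> A\<close> unfolding smooth_manifold_def by blast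
  moreover assume "x \<in> snd c ` (fst c \<inter> fst d)"
  ultimately show "(snd d \<circ> cinv c) differentiable (at x)"
    by (intro smooth_on_imp_differentiable)
qed

lemma smooth_manifold_smooth_transition:
  "smooth_manifold A \<Longrightarrow> c \<in> A \<Longrightarrow> d \<in> A
    \<Longrightarrow> smooth_on (snd c ` (fst c \<inter> fst d)) (snd d \<circ> cinv c)"
  unfolding smooth_manifold_def by blast


section \<open>Bivector fields and their graphs\<close>

context C1_atlas
begin

text \<open>\<open>topology\<close> returns the given predicate as openness once that predicate is
  known to satisfy the axioms of a topology; these are checked here.\<close>

lemma openin_mtop:
  "openin (mtop A) W \<longleftrightarrow> W \<subseteq> points A \<and> (\<forall>c\<in>A. open (snd c ` (fst c \<inter> W)))"
proof -
  have "istopology (\<lambda>W. W \<subseteq> points A \<and> (\<forall>c\<in>A. open (snd c ` (fst c \<inter> W))))"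
    unfolding istopology_def
  proof (intro conjI allI impI ballI)
    fix K and c
    assume K: "\<forall>W\<in>K. W \<subseteq> points A \<and> (\<forall>c\<in>A. open (snd c ` (fst c \<inter> W)))"
    then show "\<Union>K \<subseteq> points A" by blast
    assume "c \<in> A"
    then have "open (\<Union>W\<in>K. snd c ` (fst c \<inter> W))" using K by blast
    also have "(\<Union>W\<in>K. snd c ` (fst c \<inter> W)) = snd c ` (fst c \<inter> \<Union>K)" by blast
    finally show "open (snd c ` (fst c \<inter> \<Union>K))" .
  qed (auto intro: open_image_inter)
  then show ?thesis by (simp add: mtop_def)
qed

lemma openin_chart: "c \<in> A \<Longrightarrow> openin (mtop A) (fst c)"
  using open_overlap by (auto simp: openin_mtop points_def)

section \<open>The sharp map of a bivector field\<close>

context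
  fixes \<pi> :: "'a \<Rightarrow> ('a, 'e) covec \<Rightarrow> ('a, 'e) covec \<Rightarrow> real"
  assumes bivector: "bivector_field A \<pi>"
begin

lemma bivector_linear:
  "p \<in> points A \<Longrightarrow> \<alpha> \<in> cotangent_space A p \<Longrightarrow> linear_on_sub (cotangent_space A p) (\<pi> p \<alpha>)"
  using bivector unfolding bivector_field_def by blast

lemma bivector_skew:
  "p \<in> points A \<Longrightarrow> \<alpha> \<in> cotangent_space A p \<Longrightarrow> \<beta> \<in> cotangent_space A p
    \<Longrightarrow> \<pi> p \<alpha> \<beta> = - \<pi> p \<beta> \<alpha>"
  using bivector unfolding bivector_field_def by blast

text \<open>Since covectors separate tangent vectors, the description defining \<open>sharp\<close>
  has at most one solution. Any computation of \<open>sharp\<close> thus reduces to exhibiting a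
  solution.\<close>

lemma sharp_unique:
  assumes "p \<in> points A" "X \<in> tangent_space A p"
    and "\<And>\<beta>. \<beta> \<in> cotangent_space A p \<Longrightarrow> \<beta> X = \<pi> p \<alpha> \<beta>"
  shows "sharp A \<pi> p \<alpha> = X"
  unfolding sharp_def
proof (rule the_equality)
  show "Y = X" if "Y \<in> tangent_space A p \<and> (\<forall>\<beta>\<in>cotangent_space A p. \<beta> Y = \<pi> p \<alpha> \<beta>)" for Y
    using that assms by (intro covectors_separate) auto
qed (use assms in blast)

text \<open>Existence for the description defining \<open>sharp\<close>: the vector whose
  coordinates are the values of \<pi> on \<alpha> and the coordinate covectors is a solution, by
  linearity in the second argument.\<close>

lemma bivector_contraction:
  assumes "c \<in> charts_at A p" "\<alpha> \<in> cotangent_space A p" "\<beta> \<in> cotangent_space A p"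
  shows "\<beta> (coord_vec A c p (\<Sum>b\<in>Basis. \<pi> p \<alpha> (coord_covec A c p b) *\<^sub>R b)) = \<pi> p \<alpha> \<beta>"
proof -
  have p: "p \<in> points A" using chart_atD[OF assms(1)] by simp
  obtain z where \<beta>: "\<beta> = coord_covec A c p z"
    using cotangent_space_eq_range[OF assms(1)] assms(3) by blast
  have lin: "linear (\<lambda>z. \<pi> p \<alpha> (coord_covec A c p z))"
    using linear_on_sub_compose_linear[OF bivector_linear[OF p assms(2)] linear_coord_covec
      coord_covec_in] .
  have "\<pi> p \<alpha> \<beta> = \<pi> p \<alpha> (coord_covec A c p (\<Sum>b\<in>Basis. (z \<bullet> b) *\<^sub>R b))"
    by (simp add: \<beta> euclidean_representation)
  also have "\<dots> = (\<Sum>b\<in>Basis. (z \<bullet> b) * \<pi> p \<alpha> (coord_covec A c p b))"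
    by (simp add: linear_sum[OF lin] linear_scale[OF lin])
  finally show ?thesis
    unfolding \<beta> coord_covec_coord_vec[OF assms(1)]
    by (simp add: inner_sum_left inner_sum_right mult.commute inner_commute)
qed

lemma sharp_eq_coord_vec:
  assumes "c \<in> charts_at A p" "\<alpha> \<in> cotangent_space A p"
  shows "sharp A \<pi> p \<alpha> = coord_vec A c p (\<Sum>b\<in>Basis. \<pi> p \<alpha> (coord_covec A c p b) *\<^sub>R b)"
  using sharp_unique[OF chart_atD(3)[OF assms(1)] coord_vec_in[OF assms(1)]]
    bivector_contraction[OF assms] by blast

lemma sharp_in:
  assumes "p \<in> points A" "\<alpha> \<in> cotangent_space A p"
  shows "sharp A \<pi> p \<alpha> \<in> tangent_space A p"
  unfolding sharp_eq_coord_vec[OF chart_at_in[OF assms(1)] assms(2)]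
  by (rule coord_vec_in[OF chart_at_in[OF assms(1)]])

lemma sharp_apply:
  assumes "p \<in> points A" "\<alpha> \<in> cotangent_space A p" "\<beta> \<in> cotangent_space A p"
  shows "\<beta> (sharp A \<pi> p \<alpha>) = \<pi> p \<alpha> \<beta>"
  unfolding sharp_eq_coord_vec[OF chart_at_in[OF assms(1)] assms(2)]
  by (rule bivector_contraction[OF chart_at_in[OF assms(1)] assms(2,3)])

text \<open>\<open>bivector_field\<close> states linearity in the second argument, whereas this is
  linearity in the first. Skew-symmetry is applied before and after the linear step to exchange
  them.\<close>

lemma linear_on_sub_sharp:
  assumes "p \<in> points A"
  shows "linear_on_sub (cotangent_space A p) (sharp A \<pi> p)"
  unfolding linear_on_sub_def
proof (intro conjI ballI allI)
  note tangent = subspace_add[OF subspace_tangent_space] subspace_scale[OF subspace_tangent_space]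
    sharp_in[OF assms]
  have cov: "linear_on_sub (tangent_space A p) \<gamma>" if "\<gamma> \<in> cotangent_space A p" for \<gamma>
    using that by (simp add: cotangent_space_def)
  fix \<alpha> assume \<alpha>: "\<alpha> \<in> cotangent_space A p"
  {
    fix \<beta> assume \<beta>: "\<beta> \<in> cotangent_space A p"
    have sum: "\<alpha> + \<beta> \<in> cotangent_space A p"
      using subspace_add[OF subspace_cotangent_space[OF assms] \<alpha> \<beta>] .
    show "sharp A \<pi> p (\<alpha> + \<beta>) = sharp A \<pi> p \<alpha> + sharp A \<pi> p \<beta>"
    proof (rule sharp_unique[OF assms])
      show "sharp A \<pi> p \<alpha> + sharp A \<pi> p \<beta> \<in> tangent_space A p" using tangent \<alpha> \<beta> by blast
      fix \<gamma> assume \<gamma>: "\<gamma> \<in> cotangent_space A p"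
      have "\<gamma> (sharp A \<pi> p \<alpha> + sharp A \<pi> p \<beta>) = \<pi> p \<alpha> \<gamma> + \<pi> p \<beta> \<gamma>"
        using linear_on_sub_add[OF cov[OF \<gamma>]] sharp_in[OF assms] sharp_apply[OF assms] \<alpha> \<beta> \<gamma> by simp
      also have "\<dots> = - (\<pi> p \<gamma> \<alpha> + \<pi> p \<gamma> \<beta>)"
        using bivector_skew[OF assms _ \<gamma>] \<alpha> \<beta> by simp
      also have "\<dots> = - \<pi> p \<gamma> (\<alpha> + \<beta>)"
        using linear_on_sub_add[OF bivector_linear[OF assms \<gamma>] \<alpha> \<beta>] by simp
      also have "\<dots> = \<pi> p (\<alpha> + \<beta>) \<gamma>" using bivector_skew[OF assms sum \<gamma>] by simp
      finally show "\<gamma> (sharp A \<pi> p \<alpha> + sharp A \<pi> p \<beta>) = \<pi> p (\<alpha> + \<beta>) \<gamma>" .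
    qed
  }
  fix r :: real
  have scaled: "r *\<^sub>R \<alpha> \<in> cotangent_space A p"
    using subspace_scale[OF subspace_cotangent_space[OF assms] \<alpha>] .
  show "sharp A \<pi> p (r *\<^sub>R \<alpha>) = r *\<^sub>R sharp A \<pi> p \<alpha>"
  proof (rule sharp_unique[OF assms])
    show "r *\<^sub>R sharp A \<pi> p \<alpha> \<in> tangent_space A p" using tangent \<alpha> by blast
    fix \<gamma> assume \<gamma>: "\<gamma> \<in> cotangent_space A p"
    have "\<gamma> (r *\<^sub>R sharp A \<pi> p \<alpha>) = r * \<pi> p \<alpha> \<gamma>"
      using linear_on_sub_scaleR[OF cov[OF \<gamma>]] sharp_in[OF assms] sharp_apply[OF assms] \<alpha> \<gamma> by simp
    also have "\<dots> = - (r * \<pi> p \<gamma> \<alpha>)" using bivector_skew[OF assms \<alpha> \<gamma>] by simp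
    also have "\<dots> = - \<pi> p \<gamma> (r *\<^sub>R \<alpha>)"
      using linear_on_sub_scaleR[OF bivector_linear[OF assms \<gamma>] \<alpha>] by simp
    also have "\<dots> = \<pi> p (r *\<^sub>R \<alpha>) \<gamma>" using bivector_skew[OF assms scaled \<gamma>] by simp
    finally show "\<gamma> (r *\<^sub>R sharp A \<pi> p \<alpha>) = \<pi> p (r *\<^sub>R \<alpha>) \<gamma>" .
  qed
qed

lemma linear_sharp_coord_covec:
  "p \<in> points A \<Longrightarrow> linear (\<lambda>z. sharp A \<pi> p (coord_covec A c p z))"
  using linear_on_sub_compose_linear[OF linear_on_sub_sharp linear_coord_covec coord_covec_in] .

lemma linear_graph_param:
  assumes "p \<in> points A"
  shows "linear (\<lambda>z. (sharp A \<pi> p (coord_covec A c p z), coord_covec A c p z))"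
proof -
  note lin = linear_on_subD[OF linear_on_sub_sharp[OF assms]]
  show ?thesis
    by (rule linearI) (simp_all add: linear_add[OF linear_coord_covec]
      linear_scale[OF linear_coord_covec] lin coord_covec_in)
qed

section \<open>The graph as an almost Dirac structure\<close>

lemma bivector_graph_eq_range:
  assumes "c \<in> charts_at A p"
  shows "bivector_graph A \<pi> p =
    range (\<lambda>z. (sharp A \<pi> p (coord_covec A c p z), coord_covec A c p z))"
  unfolding bivector_graph_def cotangent_space_eq_range[OF assms] by blast

text \<open>The pairing of the elements over \<alpha> and \<beta> is
  \<open>\<pi> p \<beta> \<alpha> + \<pi> p \<alpha> \<beta>\<close>, which vanishes by
  skew-symmetry.\<close>

lemma isotropic_bivector_graph:
  assumes "p \<in> points A"
  shows "isotropic_subspace A p (bivector_graph A \<pi> p)"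
  unfolding isotropic_subspace_def
proof (intro conjI ballI)
  show "subspace (bivector_graph A \<pi> p)"
    unfolding bivector_graph_eq_range[OF chart_at_in[OF assms]]
    by (rule linear_subspace_image[OF linear_graph_param[OF assms] subspace_UNIV])
  show "bivector_graph A \<pi> p \<subseteq> tangent_space A p \<times> cotangent_space A p"
    using sharp_in[OF assms] by (auto simp: bivector_graph_def)
  fix x y assume "x \<in> bivector_graph A \<pi> p" "y \<in> bivector_graph A \<pi> p"
  then obtain \<alpha> \<beta> where "x = (sharp A \<pi> p \<alpha>, \<alpha>)" "y = (sharp A \<pi> p \<beta>, \<beta>)"
    and "\<alpha> \<in> cotangent_space A p" "\<beta> \<in> cotangent_space A p"
    unfolding bivector_graph_def by blast
  then show "dirac_pairing x y = 0"
    using bivector_skew[OF assms, of \<alpha> \<beta>] by (simp add: sharp_apply[OF assms] dirac_pairing_def)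
qed

text \<open>If \<open>(X, \<beta>)\<close> pairs to zero with every graph element, then each
  covector \<alpha> takes the value
  \<open>- \<pi> p \<alpha> \<beta> = \<pi> p \<beta> \<alpha>\<close> on \<open>X\<close>. This is
  the property characterising the sharp of \<beta>, so \<open>(X, \<beta>)\<close> already lies on
  the graph.\<close>

lemma maximal_isotropic_bivector_graph:
  assumes "p \<in> points A" "isotropic_subspace A p K" "bivector_graph A \<pi> p \<subseteq> K"
  shows "K = bivector_graph A \<pi> p"
proof (intro equalityI assms(3) subrelI)
  fix X \<beta> assume X\<beta>: "(X, \<beta>) \<in> K"
  then have X: "X \<in> tangent_space A p" and \<beta>: "\<beta> \<in> cotangent_space A p"
    using assms(2) by (auto simp: isotropic_subspace_def)
  have "\<alpha> X = \<pi> p \<beta> \<alpha>" if \<alpha>: "\<alpha> \<in> cotangent_space A p" for \<alpha>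
  proof -
    have "(sharp A \<pi> p \<alpha>, \<alpha>) \<in> K" using assms(3) \<alpha> by (auto simp: bivector_graph_def)
    then have "dirac_pairing (X, \<beta>) (sharp A \<pi> p \<alpha>, \<alpha>) = 0"
      using assms(2) X\<beta> unfolding isotropic_subspace_def by blast
    then show ?thesis
      using sharp_apply[OF assms(1) \<alpha> \<beta>] bivector_skew[OF assms(1) \<alpha> \<beta>]
      by (simp add: dirac_pairing_def)
  qed
  then have "X = sharp A \<pi> p \<beta>" using sharp_unique[OF assms(1) X] by metis
  then show "(X, \<beta>) \<in> bivector_graph A \<pi> p" using \<beta> by (auto simp: bivector_graph_def)
qed

text \<open>The second component alone makes the parametrisation injective, so the image of the
  standard basis stays independent.\<close>

lemma bivector_graph_frame:
  assumes "c \<in> charts_at A p"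
  defines "\<Phi> \<equiv> \<lambda>z. (sharp A \<pi> p (coord_covec A c p z), coord_covec A c p z)"
  shows "bivector_graph A \<pi> p = span (\<Phi> ` Basis)" "dim (bivector_graph A \<pi> p) = DIM('e)"
proof -
  have lin: "linear \<Phi>"
    unfolding \<Phi>_def by (rule linear_graph_param[OF chart_atD(3)[OF assms(1)]])
  have inj: "inj \<Phi>"
    using inj_coord_covec[OF assms(1)] by (simp add: \<Phi>_def inj_on_def)
  show graph: "bivector_graph A \<pi> p = span (\<Phi> ` Basis)"
    using bivector_graph_eq_range[OF assms(1)] span_linear_image[OF lin, of Basis]
    by (simp add: \<Phi>_def)
  have "independent (\<Phi> ` Basis)"
    by (rule real_vector.linear_independent_injective_image[OF lin independent_Basis])
      (rule inj_on_subset[OF inj subset_UNIV])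
  then have "dim (bivector_graph A \<pi> p) = card (\<Phi> ` Basis)"
    by (simp add: graph dim_eq_card_independent)
  also have "\<dots> = DIM('e)" by (rule card_image[OF inj_on_subset[OF inj subset_UNIV]])
  finally show "dim (bivector_graph A \<pi> p) = DIM('e)" .
qed

text \<open>The section is built from the chart \<open>c\<close> but has to be tested in every chart
  \<open>d\<close>. Both components are rewritten in the coordinates of \<open>d\<close>, with
  coefficients taken from the Jacobian \<open>J\<close> of the change from \<open>d\<close> to
  \<open>c\<close>.\<close>

lemma smooth_bivector_frame:
  assumes "smooth_manifold A" "c \<in> A"
  shows "smooth_section A (fst c) (\<lambda>p. (sharp A \<pi> p (coord_covec A c p z), coord_covec A c p z))"
  unfolding smooth_section_def
proof (intro conjI ballI allI)
  fix p assume "p \<in> fst c"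
  then have "p \<in> points A" using assms(2) by (auto simp: points_def)
  then show "(sharp A \<pi> p (coord_covec A c p z), coord_covec A c p z)
      \<in> tangent_space A p \<times> cotangent_space A p"
    using sharp_in coord_covec_in by simp
next
  fix d assume d: "d \<in> A"
  define S where "S = snd d ` (fst d \<inter> fst c)"
  define J where "J = (\<lambda>x. frechet_derivative (snd c \<circ> cinv d) (at x))"
  have S: "open S" using open_overlap[OF d assms(2)] by (simp add: S_def)
  have J: "smooth_on S (\<lambda>x. J x v)" for v
    unfolding J_def S_def
    using smooth_on_frechet_derivative smooth_manifold_smooth_transition[OF assms(1) d assms(2)] .
  have at: "snd d (cinv d x) = x" "c \<in> charts_at A (cinv d x)" "d \<in> charts_at A (cinv d x)"
    if "x \<in> S" for x
    using chart_cinv[OF d that[unfolded S_def]] charts_atI assms(2) d by auto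
  have covec: "coord_covec A c (cinv d x) z (coord_vec A d (cinv d x) v) = J x v \<bullet> z"
    if "x \<in> S" for x v
    using at[OF that] coord_vec_in[of d "cinv d x"]
    by (simp add: coord_covec_def coord_vec_apply J_def)
  show "smooth_on (snd d ` (fst d \<inter> fst c))
      (\<lambda>x. snd (sharp A \<pi> (cinv d x) (coord_covec A c (cinv d x) z), coord_covec A c (cinv d x) z)
        (coord_vec A d (cinv d x) v))" for v
    unfolding S_def[symmetric] snd_conv
    by (rule smooth_on_cong[OF S smooth_on_inner[OF S J smooth_on_const]])
      (simp add: covec)
  \<comment> \<open>Expanding the covector in the coordinate covectors of \<open>d\<close> leaves
    \<pi> evaluated on pairs of these only, and for such pairs smoothness is part of
    \<open>bivector_field\<close>.\<close>
  have sharp: "sharp A \<pi> (cinv d x) (coord_covec A c (cinv d x) z) d =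
      (\<Sum>b\<in>Basis. (J x b \<bullet> z) *\<^sub>R (\<Sum>b'\<in>Basis.
        \<pi> (cinv d x) (coord_covec A d (cinv d x) b) (coord_covec A d (cinv d x) b') *\<^sub>R b'))"
    (is "_ = (\<Sum>b\<in>Basis. _ *\<^sub>R ?X b)") if x: "x \<in> S" for x
  proof -
    have p: "cinv d x \<in> points A" using chart_atD at[OF x] by blast
    have "coord_covec A c (cinv d x) z =
        coord_covec A d (cinv d x) (\<Sum>b\<in>Basis. (J x b \<bullet> z) *\<^sub>R b)"
      using cotangent_eq_coord_covec[OF at(3)[OF x] coord_covec_in, of c z] covec[OF x] by simp
    then have "sharp A \<pi> (cinv d x) (coord_covec A c (cinv d x) z) =
        (\<Sum>b\<in>Basis. (J x b \<bullet> z) *\<^sub>R sharp A \<pi> (cinv d x) (coord_covec A d (cinv d x) b))"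
      by (simp add: linear_sum[OF linear_sharp_coord_covec[OF p]]
        linear_scale[OF linear_sharp_coord_covec[OF p]])
    moreover have "sharp A \<pi> (cinv d x) (coord_covec A d (cinv d x) b) d = ?X b" for b
      using sharp_eq_coord_vec[OF at(3)[OF x] coord_covec_in] at(3)[OF x] by simp
    ultimately show ?thesis by simp
  qed
  have \<pi>: "smooth_on S (\<lambda>x. \<pi> (cinv d x) (coord_covec A d (cinv d x) b) (coord_covec A d (cinv d x) b'))"
    if "b \<in> Basis" "b' \<in> Basis" for b b'
  proof (rule smooth_on_subset)
    show "smooth_on (snd d ` fst d)
        (\<lambda>x. \<pi> (cinv d x) (coord_covec A d (cinv d x) b) (coord_covec A d (cinv d x) b'))"
      using bivector d that unfolding bivector_field_def by blast
  qed (auto simp: S_def)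
  show "smooth_on (snd d ` (fst d \<inter> fst c))
      (\<lambda>x. fst (sharp A \<pi> (cinv d x) (coord_covec A c (cinv d x) z), coord_covec A c (cinv d x) z) d)"
    unfolding S_def[symmetric] fst_conv
  proof (rule smooth_on_cong[OF S])
    show "smooth_on S (\<lambda>x. \<Sum>b\<in>Basis. (J x b \<bullet> z) *\<^sub>R (\<Sum>b'\<in>Basis.
        \<pi> (cinv d x) (coord_covec A d (cinv d x) b) (coord_covec A d (cinv d x) b') *\<^sub>R b'))"
      using S J \<pi> by (intro smooth_on_sum smooth_on_scaleR smooth_on_inner smooth_on_const)
  qed (simp add: sharp)
qed

lemma almost_dirac_bivector_graph:
  assumes "smooth_manifold A"
  shows "almost_dirac A (bivector_graph A \<pi>)"
  unfolding almost_dirac_def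
proof (intro conjI ballI allI impI)
  \<comment> \<open>\<open>subbundle\<close> indexes frames by the numbers below the rank, so the
    basis has to be enumerated.\<close>
  obtain h :: "nat \<Rightarrow> 'e" where "bij_betw h {0..<DIM('e)} Basis"
    using ex_bij_betw_nat_finite[OF finite_Basis] by blast
  then have h: "h ` {..<DIM('e)} = Basis" by (simp add: bij_betw_def lessThan_atLeast0)
  show "subbundle A (bivector_graph A \<pi>)"
    unfolding subbundle_def
  proof (intro exI[of _ "DIM('e)"] ballI)
    fix p assume "p \<in> points A"
    then obtain c where c: "c \<in> A" "p \<in> fst c" by (auto simp: points_def)
    define s where "s i x = (sharp A \<pi> x (coord_covec A c x (h i)), coord_covec A c x (h i))" for i x
    have image: "(\<lambda>i. s i x) ` {..<DIM('e)} =
        (\<lambda>z. (sharp A \<pi> x (coord_covec A c x z), coord_covec A c x z)) ` Basis" for x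
      using image_image[of "\<lambda>z. (sharp A \<pi> x (coord_covec A c x z), coord_covec A c x z)" h
        "{..<DIM('e)}"] unfolding h s_def by simp
    show "\<exists>W s. openin (mtop A) W \<and> p \<in> W \<and> (\<forall>i<DIM('e). smooth_section A W (s i)) \<and>
        (\<forall>x\<in>W. bivector_graph A \<pi> x = span ((\<lambda>i. s i x) ` {..<DIM('e)}) \<and>
          dim (bivector_graph A \<pi> x) = DIM('e))"
    proof (intro exI[of _ "fst c"] exI[of _ s] conjI allI impI ballI)
      show "openin (mtop A) (fst c)" using openin_chart c by blast
      show "p \<in> fst c" by fact
      show "smooth_section A (fst c) (s i)" for i
        unfolding s_def using smooth_bivector_frame[OF assms c(1)] .
      fix x assume "x \<in> fst c"
      then have "c \<in> charts_at A x" using charts_atI c(1) by blast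
      from bivector_graph_frame[OF this]
      show "bivector_graph A \<pi> x = span ((\<lambda>i. s i x) ` {..<DIM('e)})"
        "dim (bivector_graph A \<pi> x) = DIM('e)"
        unfolding image .
    qed
  qed
  fix p assume "p \<in> points A"
  then show "isotropic_subspace A p (bivector_graph A \<pi> p)" by (rule isotropic_bivector_graph)
  show "K = bivector_graph A \<pi> p"
    if "isotropic_subspace A p K \<and> bivector_graph A \<pi> p \<subseteq> K" for K
    using maximal_isotropic_bivector_graph[OF \<open>p \<in> points A\<close>] that by blast
qed

end

text \<open>The fibres are compared over points of the manifold only. This covers the local frames
  too, because an open set of \<open>mtop\<close> consists of such points.\<close>

lemma almost_dirac_cong:
  assumes "\<And>p. p \<in> points A \<Longrightarrow> L p = L' p" "almost_dirac A L"
  shows "almost_dirac A L'"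
proof -
  obtain r where r: "\<forall>p\<in>points A. \<exists>W s. openin (mtop A) W \<and> p \<in> W \<and>
      (\<forall>i<r. smooth_section A W (s i)) \<and>
      (\<forall>x\<in>W. L x = span ((\<lambda>i. s i x) ` {..<r}) \<and> dim (L x) = r)"
    using assms(2) unfolding almost_dirac_def subbundle_def by (elim conjE exE)
  have "subbundle A L'"
    unfolding subbundle_def
  proof (intro exI[of _ r] ballI)
    fix p assume "p \<in> points A"
    from bspec[OF r this] obtain W s where W: "openin (mtop A) W" "p \<in> W"
      "\<forall>i<r. smooth_section A W (s i)"
      and L: "\<forall>x\<in>W. L x = span ((\<lambda>i. s i x) ` {..<r}) \<and> dim (L x) = r"
      by (elim exE conjE)
    have "L' x = span ((\<lambda>i. s i x) ` {..<r}) \<and> dim (L' x) = r" if "x \<in> W" for x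
    proof -
      have "x \<in> points A" using W(1) that unfolding openin_mtop by blast
      from bspec[OF L that] show ?thesis unfolding assms(1)[OF \<open>x \<in> points A\<close>] .
    qed
    then have "\<forall>x\<in>W. L' x = span ((\<lambda>i. s i x) ` {..<r}) \<and> dim (L' x) = r"
      by (rule ballI)
    then show "\<exists>W s. openin (mtop A) W \<and> p \<in> W \<and> (\<forall>i<r. smooth_section A W (s i)) \<and>
        (\<forall>x\<in>W. L' x = span ((\<lambda>i. s i x) ` {..<r}) \<and> dim (L' x) = r)"
      by (intro exI[of _ W] exI[of _ s] conjI W)
  qed
  moreover have "isotropic_subspace A p (L' p) \<and>
      (\<forall>K. isotropic_subspace A p K \<and> L' p \<subseteq> K \<longrightarrow> K = L' p)" if "p \<in> points A" for p
  proof -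
    have "isotropic_subspace A p (L p) \<and>
        (\<forall>K. isotropic_subspace A p K \<and> L p \<subseteq> K \<longrightarrow> K = L p)"
      using assms(2) that unfolding almost_dirac_def by (elim conjE) (rule bspec)
    then show ?thesis unfolding assms(1)[OF that] .
  qed
  ultimately show ?thesis unfolding almost_dirac_def by (rule conjI[OF _ ballI])
qed

end


section \<open>Differentiable maps\<close>

text \<open>Matches the first-order setting of \<open>C1_atlas\<close>, so that it applies to the
  bundle projection and to the inclusion of the constraint submanifold.\<close>

locale C1_map = src: C1_atlas A + tgt: C1_atlas B
  for A :: "('a, 'e::euclidean_space) atlas" and B :: "('b, 'f::euclidean_space) atlas" +
  fixes F :: "'a \<Rightarrow> 'b"
  assumes maps_points: "p \<in> points A \<Longrightarrow> F p \<in> points B"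
    and open_preimage: "c \<in> A \<Longrightarrow> d \<in> B \<Longrightarrow> open (snd c ` (fst c \<inter> F -` fst d))"
    and differentiable_in_charts: "c \<in> A \<Longrightarrow> d \<in> B \<Longrightarrow> x \<in> snd c ` (fst c \<inter> F -` fst d)
      \<Longrightarrow> (snd d \<circ> F \<circ> cinv c) differentiable (at x)"
begin

lemma has_derivative_in_charts:
  assumes "c \<in> charts_at A p" "d \<in> charts_at B (F p)"
  shows "((snd d \<circ> F \<circ> cinv c) has_derivative frechet_derivative (snd d \<circ> F \<circ> cinv c) (at (snd c p)))
    (at (snd c p))"
proof -
  have "snd c p \<in> snd c ` (fst c \<inter> F -` fst d)"
    using src.chart_atD[OF assms(1)] tgt.chart_atD[OF assms(2)] by blast
  then show ?thesis
    using differentiable_in_charts src.chart_atD[OF assms(1)] tgt.chart_atD[OF assms(2)]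
    by (simp add: frechet_derivative_works)
qed

text \<open>Chain rule with an intermediate chart \<open>d\<close> of the target. The two
  expressions agree on the part of \<open>c\<close> mapped into \<open>d\<close>, whose image is
  open by \<open>open_preimage\<close>.\<close>

lemma has_derivative_compose:
  assumes "c \<in> charts_at A p" "d \<in> charts_at B (F p)"
    and "((h \<circ> cinv d) has_derivative h') (at (snd d (F p)))"
  shows "((h \<circ> F \<circ> cinv c) has_derivative
    h' \<circ> frechet_derivative (snd d \<circ> F \<circ> cinv c) (at (snd c p))) (at (snd c p))"
proof -
  note c = src.chart_atD[OF assms(1)] and d = tgt.chart_atD[OF assms(2)]
  have "((h \<circ> cinv d) has_derivative h') (at ((snd d \<circ> F \<circ> cinv c) (snd c p)))"
    using assms(3) by (simp add: src.cinv_chart[OF c(1,2)])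
  from diff_chain_at[OF has_derivative_in_charts[OF assms(1,2)] this]
  show ?thesis
  proof (rule has_derivative_transform_within_open[OF _ open_preimage[OF c(1) d(1)]])
    show "snd c p \<in> snd c ` (fst c \<inter> F -` fst d)" using c d by blast
    show "((h \<circ> cinv d) \<circ> (snd d \<circ> F \<circ> cinv c)) x = (h \<circ> F \<circ> cinv c) x"
      if "x \<in> snd c ` (fst c \<inter> F -` fst d)" for x
      using src.chart_cinv[OF c(1) that] tgt.cinv_chart[OF d(1)] by simp
  qed
qed

text \<open>\<open>tangent_map\<close> is computed in a chart picked by choice; the chain rule for
  the change to that chart shows that every chart gives the same components.\<close>

lemma tangent_map_chart:
  assumes "c \<in> charts_at A p" "d \<in> charts_at B (F p)" "v \<in> tangent_space A p"
  shows "tangent_map A B F p v d = frechet_derivative (snd d \<circ> F \<circ> cinv c) (at (snd c p)) (v c)"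
proof -
  define c0 where "c0 = chart_at A p"
  have c0: "c0 \<in> charts_at A p"
    using src.chart_at_in src.chart_atD[OF assms(1)] by (simp add: c0_def)
  have "frechet_derivative (snd d \<circ> F \<circ> cinv c) (at (snd c p)) =
      frechet_derivative (snd d \<circ> F \<circ> cinv c0) (at (snd c0 p)) \<circ> transition_deriv c c0 p"
    by (rule frechet_derivative_at[symmetric])
      (rule src.has_derivative_change_chart[OF assms(1) c0 has_derivative_in_charts[OF c0 assms(2)]])
  moreover have "transition_deriv c c0 p (v c) = v c0"
    using src.tangent_eq_coord_vec[OF assms(1,3)] src.coord_vec_apply[OF c0] by metis
  ultimately show ?thesis
    using assms(2) by (simp add: tangent_map_def Let_def c0_def)
qed

text \<open>Only the component of \<open>v\<close> in the chosen source chart enters the definition;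
  compatibility of the resulting components is the chain rule in the target.\<close>

lemma tangent_map_in:
  assumes "p \<in> points A"
  shows "tangent_map A B F p v \<in> tangent_space B (F p)"
proof -
  define c where "c = chart_at A p"
  have c: "c \<in> charts_at A p" using src.chart_at_in[OF assms] by (simp add: c_def)
  have "tangent_map A B F p v e =
      frechet_derivative (snd e \<circ> cinv d) (at (snd d (F p))) (tangent_map A B F p v d)"
    if "d \<in> charts_at B (F p)" "e \<in> charts_at B (F p)" for d e
  proof -
    have "frechet_derivative (snd e \<circ> F \<circ> cinv c) (at (snd c p)) = transition_deriv d e (F p) \<circ>
        frechet_derivative (snd d \<circ> F \<circ> cinv c) (at (snd c p))"
      by (rule frechet_derivative_at[symmetric])
        (rule has_derivative_compose[OF c that(1) tgt.transition_has_derivative[OF that]])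
    then show ?thesis using that by (simp add: tangent_map_def Let_def c_def)
  qed
  moreover have "tangent_map A B F p v d = 0" if "d \<notin> charts_at B (F p)" for d
    using that by (simp add: tangent_map_def Let_def)
  ultimately show ?thesis
    unfolding tangent_space_def by (intro CollectI conjI allI impI ballI)
qed

lemma linear_on_sub_tangent_map:
  assumes "p \<in> points A"
  shows "linear_on_sub (tangent_space A p) (tangent_map A B F p)"
proof -
  have lin: "linear (frechet_derivative (snd d \<circ> F \<circ> cinv (chart_at A p)) (at (snd (chart_at A p) p)))"
    if "d \<in> charts_at B (F p)" for d
    using has_derivative_linear[OF has_derivative_in_charts[OF src.chart_at_in[OF assms] that]] .
  show ?thesis
    unfolding linear_on_sub_def
    by (intro conjI ballI allI ext)
      (simp_all add: tangent_map_def Let_def linear_add[OF lin] linear_scale[OF lin])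
qed

text \<open>Naturality of the differential. For the inclusion of a submanifold it says that the
  differential of an extension restricts to the differential of the function.\<close>

lemma differential_tangent_map:
  assumes "p \<in> points A" "v \<in> tangent_space A p"
    and "\<And>d. d \<in> charts_at B (F p) \<Longrightarrow> (h \<circ> cinv d) differentiable (at (snd d (F p)))"
    and "\<And>x. x \<in> points A \<Longrightarrow> h (F x) = f x"
  shows "differential B h (F p) (tangent_map A B F p v) = differential A f p v"
proof -
  define c where "c = chart_at A p"
  define d where "d = chart_at B (F p)"
  have c: "c \<in> charts_at A p" using src.chart_at_in[OF assms(1)] by (simp add: c_def)
  have d: "d \<in> charts_at B (F p)"
    using tgt.chart_at_in[OF maps_points[OF assms(1)]] by (simp add: d_def)
  note cA = src.chart_atD[OF c]
  have "((h \<circ> cinv d) has_derivative frechet_derivative (h \<circ> cinv d) (at (snd d (F p))))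
      (at (snd d (F p)))"
    using assms(3)[OF d] by (simp add: frechet_derivative_works)
  from has_derivative_compose[OF c d this]
  have "((f \<circ> cinv c) has_derivative frechet_derivative (h \<circ> cinv d) (at (snd d (F p))) \<circ>
      frechet_derivative (snd d \<circ> F \<circ> cinv c) (at (snd c p))) (at (snd c p))"
  proof (rule has_derivative_transform_within_open[OF _ src.open_chart_image[OF cA(1)]])
    show "snd c p \<in> snd c ` fst c" using cA by blast
    show "(h \<circ> F \<circ> cinv c) x = (f \<circ> cinv c) x" if "x \<in> snd c ` fst c" for x
      using assms(4) src.chart_cinv(2)[OF cA(1) that] src.chart_atD[OF src.charts_atI[OF cA(1)]]
      by simp
  qed
  from frechet_derivative_at[OF this]
  show ?thesis
    using tangent_map_chart[OF c d assms(2)] assms(2) tangent_map_in[OF assms(1)]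
    by (simp add: differential_def Let_def flip: c_def d_def) (metis comp_apply)
qed

end

lemma smooth_map_imp_C1_map:
  assumes "smooth_map A B F" "C1_atlas A" "C1_atlas B"
  shows "C1_map A B F"
proof -
  interpret src: C1_atlas A + tgt: C1_atlas B using assms by simp_all
  have open_pre: "open (snd c ` (fst c \<inter> F -` fst d))"
    and smooth: "smooth_on (snd c ` (fst c \<inter> F -` fst d)) (snd d \<circ> F \<circ> cinv c)"
    if "c \<in> A" "d \<in> B" for c d
    using assms(1) that unfolding smooth_map_def by blast+
  show ?thesis
  proof
    show "F p \<in> points B" if "p \<in> points A" for p
      using assms(1) that unfolding smooth_map_def by blast
  qed (use open_pre smooth_on_imp_differentiable[OF smooth open_pre] in blast)+
qed


section \<open>The cotangent bundle\<close>

locale cotangent_bundle =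
  fixes A :: "('q, 'e::euclidean_space) atlas"
  assumes smooth: "smooth_manifold A"
begin

sublocale C1_atlas A
  by (rule smooth_manifold_imp_C1_atlas[OF smooth])

section \<open>Charts of the cotangent bundle\<close>

lemma mem_cotangent_chart [simp]:
  "(q, \<alpha>) \<in> fst (cotangent_chart A c) \<longleftrightarrow> q \<in> fst c \<and> \<alpha> \<in> cotangent_space A q"
  by (simp add: cotangent_chart_def)

lemma cotangent_chart_coord_covec:
  assumes "c \<in> charts_at A q"
  shows "snd (cotangent_chart A c) (q, coord_covec A c q y) = (snd c q, y)"
  by (simp add: cotangent_chart_def coord_covec_coord_vec[OF assms] inner_commute[of _ y]
    euclidean_representation)

text \<open>Every fibre coordinate is attained by some covector, so images of overlaps are full
  cylinders over those of the base. Openness questions thereby descend to \<open>A\<close>.\<close>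

lemma cotangent_chart_overlap:
  assumes "c \<in> A"
  shows "snd (cotangent_chart A c) ` (fst (cotangent_chart A c) \<inter> fst (cotangent_chart A d)) =
    snd c ` (fst c \<inter> fst d) \<times> UNIV" (is "?L = ?R")
proof
  show "?L \<subseteq> ?R" by (auto simp: cotangent_chart_def)
  show "?R \<subseteq> ?L"
  proof clarify
    fix q y assume "q \<in> fst c" "q \<in> fst d"
    then show "(snd c q, y) \<in> ?L"
      using cotangent_chart_coord_covec[OF charts_atI[OF assms], of q y] coord_covec_in[of c q y]
      by (intro image_eqI[of _ _ "(q, coord_covec A c q y)"]) auto
  qed
qed

lemma cotangent_chart_image:
  "c \<in> A \<Longrightarrow> snd (cotangent_chart A c) ` fst (cotangent_chart A c) = snd c ` fst c \<times> UNIV"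
  using cotangent_chart_overlap[of c c] by simp

lemma inj_cotangent_chart:
  assumes "c \<in> A"
  shows "inj_on (snd (cotangent_chart A c)) (fst (cotangent_chart A c))"
proof (rule inj_onI)
  fix m m' assume mem: "m \<in> fst (cotangent_chart A c)" "m' \<in> fst (cotangent_chart A c)"
    and eq: "snd (cotangent_chart A c) m = snd (cotangent_chart A c) m'"
  obtain q \<alpha> q' \<alpha>' where m: "m = (q, \<alpha>)" "m' = (q', \<alpha>')" by fastforce
  have q: "q \<in> fst c" "q' \<in> fst c" using mem m by auto
  moreover have "snd c q = snd c q'" using eq m by (simp add: cotangent_chart_def)
  ultimately have [simp]: "q' = q" using inj_chart[OF assms] by (simp add: inj_on_eq_iff)
  note c = charts_atI[OF assms q(1)]
  obtain y y' where y: "\<alpha> = coord_covec A c q y" "\<alpha>' = coord_covec A c q y'"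
    using mem m cotangent_space_eq_range[OF c] by auto
  then have "y = y'" using eq m cotangent_chart_coord_covec[OF c] by simp
  then show "m = m'" using m y by simp
qed

lemma cinv_cotangent_chart:
  assumes "c \<in> A" "x \<in> snd c ` fst c"
  shows "cinv (cotangent_chart A c) (x, y) = (cinv c x, coord_covec A c (cinv c x) y)"
proof -
  have "cinv c x \<in> fst c" "snd c (cinv c x) = x" using chart_cinv[OF assms] by auto
  moreover from this have "snd (cotangent_chart A c) (cinv c x, coord_covec A c (cinv c x) y) = (x, y)"
    using cotangent_chart_coord_covec[OF charts_atI[OF assms(1)]] by simp
  ultimately show ?thesis
    unfolding cinv_def[of "cotangent_chart A c"]
    using coord_covec_in by (intro inv_into_f_eq[OF inj_cotangent_chart[OF assms(1)]]) auto
qed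

text \<open>Momenta transform by the transpose of the Jacobian of the inverse coordinate
  change.\<close>

lemma cotangent_transition:
  assumes "c \<in> A" "d \<in> A" "x \<in> snd c ` (fst c \<inter> fst d)"
  shows "(snd (cotangent_chart A d) \<circ> cinv (cotangent_chart A c)) (x, y) =
    ((snd d \<circ> cinv c) x,
     \<Sum>b\<in>Basis. (frechet_derivative (snd c \<circ> cinv d) (at ((snd d \<circ> cinv c) x)) b \<bullet> y) *\<^sub>R b)"
proof -
  have q: "c \<in> charts_at A (cinv c x)" "d \<in> charts_at A (cinv c x)"
    using chart_cinv(2)[OF assms(1,3)] assms(1,2) charts_atI by auto
  have "coord_covec A c (cinv c x) y (coord_vec A d (cinv c x) b) =
      transition_deriv d c (cinv c x) b \<bullet> y" for b
    by (simp add: coord_covec_def coord_vec_in[OF q(2)] coord_vec_apply[OF q(1)])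
  moreover have "x \<in> snd c ` fst c" using assms(3) by blast
  ultimately show ?thesis
    by (simp add: cinv_cotangent_chart[OF assms(1)]) (simp add: cotangent_chart_def)
qed

text \<open>The momentum component contains the Jacobian of a base coordinate change, so its
  differentiability uses second-order regularity of the base, supplied by smoothness of
  \<open>A\<close>.\<close>

lemma differentiable_cotangent_transition:
  assumes "c \<in> A" "d \<in> A" "x \<in> snd c ` (fst c \<inter> fst d)"
  shows "(snd (cotangent_chart A d) \<circ> cinv (cotangent_chart A c)) differentiable (at (x, y))"
proof -
  define t where "t = snd d \<circ> cinv c"
  define J where "J b = (\<lambda>x. frechet_derivative (snd c \<circ> cinv d) (at x) b)" for b
  have t: "t differentiable (at x)"
    unfolding t_def by (rule differentiable_transition[OF assms])
  have "smooth_on (snd d ` (fst d \<inter> fst c)) (J b)" for b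
    unfolding J_def
    by (rule smooth_on_frechet_derivative[OF smooth_manifold_smooth_transition[OF smooth assms(2,1)]])
  moreover have "t x \<in> snd d ` (fst d \<inter> fst c)"
    using chart_cinv(2)[OF assms(1,3)] by (auto simp: t_def)
  ultimately have J: "J b differentiable (at (t x))" for b
    using smooth_on_imp_differentiable open_overlap[OF assms(2,1)] by blast
  have fst: "fst differentiable (at (x, y))" and snd: "snd differentiable (at (x, y))"
    by (auto intro!: bounded_linear_imp_differentiable bounded_linear_fst bounded_linear_snd)
  have t_fst: "(\<lambda>z. t (fst z)) differentiable (at (x, y))"
    using differentiable_chain_at[OF fst] t by (simp add: o_def)
  have J_fst: "(\<lambda>z. J b (t (fst z))) differentiable (at (x, y))" for b
    using differentiable_chain_at[OF t_fst, of "J b"] J by (simp add: o_def)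
  have "(\<lambda>z. (t (fst z), \<Sum>b\<in>Basis. (J b (t (fst z)) \<bullet> snd z) *\<^sub>R b)) differentiable (at (x, y))"
    using t_fst J_fst snd
    by (intro differentiable_Pair differentiable_sum differentiable_scaleR differentiable_inner
        differentiable_const) auto
  then obtain D where D: "((\<lambda>z. (t (fst z), \<Sum>b\<in>Basis. (J b (t (fst z)) \<bullet> snd z) *\<^sub>R b))
      has_derivative D) (at (x, y))"
    unfolding differentiable_def by blast
  have "open (snd c ` (fst c \<inter> fst d) \<times> (UNIV :: 'e set))"
    using open_overlap[OF assms(1,2)] by (intro open_Times) auto
  from has_derivative_transform_within_open[OF D this]
  have "((snd (cotangent_chart A d) \<circ> cinv (cotangent_chart A c)) has_derivative D) (at (x, y))"
    using assms(3) cotangent_transition[OF assms(1,2)] by (auto simp: t_def J_def)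
  then show ?thesis unfolding differentiable_def by blast
qed

sublocale cot: C1_atlas "cotangent_atlas A"
proof
  fix c' assume "c' \<in> cotangent_atlas A"
  then obtain c where c: "c \<in> A" "c' = cotangent_chart A c" by (auto simp: cotangent_atlas_def)
  show "inj_on (snd c') (fst c')" using inj_cotangent_chart c by simp
  show "open (snd c' ` fst c')"
    using open_chart_image[OF c(1)] by (simp add: c cotangent_chart_image open_Times)
  fix d' assume "d' \<in> cotangent_atlas A"
  then obtain d where d: "d \<in> A" "d' = cotangent_chart A d" by (auto simp: cotangent_atlas_def)
  have image: "snd c' ` (fst c' \<inter> fst d') = snd c ` (fst c \<inter> fst d) \<times> UNIV"
    using cotangent_chart_overlap[OF c(1)] c d by simp
  show "open (snd c' ` (fst c' \<inter> fst d'))"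
    using open_overlap[OF c(1) d(1)] by (simp add: image open_Times)
  show "(snd d' \<circ> cinv c') differentiable (at z)" if "z \<in> snd c' ` (fst c' \<inter> fst d')" for z
    using that differentiable_cotangent_transition[OF c(1) d(1)] unfolding image
    by (auto simp: c d)
qed

lemma mem_points_cotangent:
  "m \<in> points (cotangent_atlas A) \<longleftrightarrow> fst m \<in> points A \<and> snd m \<in> cotangent_space A (fst m)"
  by (cases m) (auto simp: points_def cotangent_atlas_def)

lemma charts_at_cotangentE:
  assumes "c' \<in> charts_at (cotangent_atlas A) m"
  obtains c where "c \<in> charts_at A (fst m)" "c' = cotangent_chart A c"
  using assms by (cases m) (auto simp: charts_at_def cotangent_atlas_def)

lemma cotangent_chart_in_charts_at:
  "c \<in> charts_at A (fst m) \<Longrightarrow> m \<in> points (cotangent_atlas A)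
    \<Longrightarrow> cotangent_chart A c \<in> charts_at (cotangent_atlas A) m"
  unfolding mem_points_cotangent by (cases m) (auto simp: charts_at_def cotangent_atlas_def)

sublocale proj: C1_map "cotangent_atlas A" A fst
proof
  show "fst m \<in> points A" if "m \<in> points (cotangent_atlas A)" for m
    using that by (simp add: mem_points_cotangent)
  fix c' and d :: "('q, 'e) chart"
  assume "c' \<in> cotangent_atlas A" and d: "d \<in> A"
  then obtain c where c: "c \<in> A" "c' = cotangent_chart A c" by (auto simp: cotangent_atlas_def)
  \<comment> \<open>Inside a cotangent chart, the points over the domain of \<open>d\<close> form
    the overlap with the cotangent chart of \<open>d\<close>, so the cylinder description
    applies.\<close>
  have "fst c' \<inter> fst -` fst d = fst c' \<inter> fst (cotangent_chart A d)"
    by (auto simp: c)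
  then have image: "snd c' ` (fst c' \<inter> fst -` fst d) = snd c ` (fst c \<inter> fst d) \<times> UNIV"
    using cotangent_chart_overlap[OF c(1)] c by simp
  show op: "open (snd c' ` (fst c' \<inter> fst -` fst d))"
    using open_overlap[OF c(1) d] by (simp add: image open_Times)
  fix z assume z: "z \<in> snd c' ` (fst c' \<inter> fst -` fst d)"
  have "(snd d \<circ> cinv c) differentiable (at (fst z))"
    using z differentiable_transition[OF c(1) d] by (auto simp: image)
  then have "((snd d \<circ> cinv c) \<circ> fst) differentiable (at z)"
    by (rule differentiable_chain_at[OF bounded_linear_imp_differentiable[OF bounded_linear_fst]])
  then obtain D where D: "((snd d \<circ> cinv c \<circ> fst) has_derivative D) (at z)"
    unfolding differentiable_def by blast
  have "((snd d \<circ> fst \<circ> cinv c') has_derivative D) (at z)"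
  proof (rule has_derivative_transform_within_open[OF D op z])
    fix z' assume "z' \<in> snd c' ` (fst c' \<inter> fst -` fst d)"
    then have "z' \<in> snd c ` fst c \<times> UNIV" unfolding image by blast
    then show "(snd d \<circ> cinv c \<circ> fst) z' = (snd d \<circ> fst \<circ> cinv c') z'"
      using cinv_cotangent_chart[OF c(1)] by (auto simp: c(2))
  qed
  then show "(snd d \<circ> fst \<circ> cinv c') differentiable (at z)"
    unfolding differentiable_def by blast
qed

section \<open>The Liouville form and the canonical symplectic form\<close>

lemma tangent_proj_coord_vec:
  assumes "m \<in> points (cotangent_atlas A)" "c \<in> charts_at A (fst m)"
  shows "tangent_map (cotangent_atlas A) A fst m (coord_vec (cotangent_atlas A) (cotangent_chart A c) m e)
    = coord_vec A c (fst m) (fst e)"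
proof (rule tangent_eqI[OF assms(2) proj.tangent_map_in[OF assms(1)] coord_vec_in[OF assms(2)]])
  note c' = cotangent_chart_in_charts_at[OF assms(2,1)]
  note c = chart_atD[OF assms(2)]
  have "(snd c \<circ> fst \<circ> cinv (cotangent_chart A c) has_derivative fst) (at (snd (cotangent_chart A c) m))"
  proof (rule has_derivative_transform_within_open[OF has_derivative_fst[OF has_derivative_ident]])
    show "open (snd c ` fst c \<times> (UNIV :: 'e set))"
      using open_chart_image[OF c(1)] by (intro open_Times) auto
    show "snd (cotangent_chart A c) m \<in> snd c ` fst c \<times> UNIV"
      using cotangent_chart_image[OF c(1)] cot.chart_atD[OF c'] by blast
    show "fst z = (snd c \<circ> fst \<circ> cinv (cotangent_chart A c)) z" if "z \<in> snd c ` fst c \<times> UNIV" for z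
      using that chart_cinv(1)[OF c(1)] cinv_cotangent_chart[OF c(1)] by fastforce
  qed
  then show "tangent_map (cotangent_atlas A) A fst m
      (coord_vec (cotangent_atlas A) (cotangent_chart A c) m e) c = coord_vec A c (fst m) (fst e) c"
    using proj.tangent_map_chart[OF c' assms(2) cot.coord_vec_in[OF c']]
    by (simp add: frechet_derivative_at[symmetric] c' assms(2))
qed

text \<open>This is the formula \<open>\<Theta> = \<Sum> p\<^sub>i dq\<^sup>i\<close>, with
  \<open>snd z\<close> the momenta and \<open>fst e\<close> the position part of the vector: the
  projection keeps that part and the covector is paired with it.\<close>

lemma liouville_form_coords:
  assumes "c \<in> A" "z \<in> snd c ` fst c \<times> UNIV"
  shows "liouville_form A (cinv (cotangent_chart A c) z)
    (coord_vec (cotangent_atlas A) (cotangent_chart A c) (cinv (cotangent_chart A c) z) e) =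
    fst e \<bullet> snd z"
proof -
  obtain x y where z: "z = (x, y)" "x \<in> snd c ` fst c" using assms(2) by (cases z) auto
  have c: "c \<in> charts_at A (cinv c x)"
    using chart_cinv(2)[OF assms(1) z(2)] charts_atI[OF assms(1)] by simp
  have "(cinv c x, coord_covec A c (cinv c x) y) \<in> points (cotangent_atlas A)"
    using chart_atD[OF c] coord_covec_in by (simp add: mem_points_cotangent)
  then show ?thesis
    using tangent_proj_coord_vec[of "(cinv c x, coord_covec A c (cinv c x) y)" c e] c
    by (simp add: z liouville_form_def cinv_cotangent_chart[OF assms(1)] coord_covec_coord_vec)
qed

text \<open>The canonical expression \<open>\<Sum> dq\<^sup>i \<and> dp\<^sub>i\<close>. The
  coefficients of the Liouville form depend only on the momenta, and linearly, so their derivatives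
  can be read off. The chart is the one chosen in \<open>ext_deriv\<close>.\<close>

lemma Omega_Q_coords:
  assumes "m \<in> points (cotangent_atlas A)"
    and "u \<in> tangent_space (cotangent_atlas A) m" "v \<in> tangent_space (cotangent_atlas A) m"
  defines "c' \<equiv> chart_at (cotangent_atlas A) m"
  shows "Omega_Q A m u v = fst (u c') \<bullet> snd (v c') - snd (u c') \<bullet> fst (v c')"
proof -
  have c': "c' \<in> charts_at (cotangent_atlas A) m"
    using cot.chart_at_in[OF assms(1)] by (simp add: c'_def)
  obtain c where c: "c \<in> charts_at A (fst m)" "c' = cotangent_chart A c"
    using charts_at_cotangentE[OF c'] .
  note cA = chart_atD[OF c(1)]
  define w where "w e z = liouville_form A (cinv c' z) (coord_vec (cotangent_atlas A) c' (cinv c' z) e)"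
    for e z
  have "(w e has_derivative (\<lambda>h. fst e \<bullet> snd h)) (at (snd c' m))" for e
  proof (rule has_derivative_transform_within_open)
    show "((\<lambda>z. fst e \<bullet> snd z) has_derivative (\<lambda>h. fst e \<bullet> snd h)) (at (snd c' m))"
      by (intro has_derivative_inner_right has_derivative_snd has_derivative_ident)
    show "open (snd c ` fst c \<times> (UNIV :: 'e set))"
      using open_chart_image[OF cA(1)] by (intro open_Times) auto
    show "snd c' m \<in> snd c ` fst c \<times> UNIV"
      using cotangent_chart_image[OF cA(1)] cot.chart_atD[OF c'] c(2) by blast
    show "fst e \<bullet> snd z = w e z" if "z \<in> snd c ` fst c \<times> UNIV" for z
      using liouville_form_coords[OF cA(1) that] by (simp add: w_def c(2))
  qed
  then have "frechet_derivative (w e) (at (snd c' m)) = (\<lambda>h. fst e \<bullet> snd h)" for e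
    by (rule frechet_derivative_at[symmetric])
  moreover have "Omega_Q A m u v = frechet_derivative (w (u c')) (at (snd c' m)) (v c') -
      frechet_derivative (w (v c')) (at (snd c' m)) (u c')"
    by (simp add: Omega_Q_def ext_deriv_def Let_def w_def[abs_def] flip: c'_def)
  ultimately show ?thesis by (simp add: inner_commute)
qed

lemma linear_on_sub_Omega_Q:
  assumes "m \<in> points (cotangent_atlas A)" "v \<in> tangent_space (cotangent_atlas A) m"
  shows "linear_on_sub (tangent_space (cotangent_atlas A) m) (\<lambda>u. Omega_Q A m u v)"
  using subspace_add[OF cot.subspace_tangent_space] subspace_scale[OF cot.subspace_tangent_space] assms
  by (auto simp: linear_on_sub_def Omega_Q_coords algebra_simps)

text \<open>Testing on pure momentum vectors recovers the position part of a vector, and testing on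
  pure position vectors the momentum part.\<close>

lemma Omega_Q_nondegenerate:
  assumes "m \<in> points (cotangent_atlas A)"
    and "u \<in> tangent_space (cotangent_atlas A) m" "u' \<in> tangent_space (cotangent_atlas A) m"
    and "\<And>v. v \<in> tangent_space (cotangent_atlas A) m \<Longrightarrow> Omega_Q A m u v = Omega_Q A m u' v"
  shows "u = u'"
proof -
  define c' where "c' = chart_at (cotangent_atlas A) m"
  have c': "c' \<in> charts_at (cotangent_atlas A) m"
    using cot.chart_at_in[OF assms(1)] by (simp add: c'_def)
  have eq: "fst (u c') \<bullet> snd e - snd (u c') \<bullet> fst e = fst (u' c') \<bullet> snd e - snd (u' c') \<bullet> fst e" for e
    using assms(4)[OF cot.coord_vec_in[OF c']] assms(1-3) c'
    by (simp add: Omega_Q_coords cot.coord_vec_in flip: c'_def)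
  have "\<forall>a. fst (u c') \<bullet> a = fst (u' c') \<bullet> a" "\<forall>a. snd (u c') \<bullet> a = snd (u' c') \<bullet> a"
    using eq[of "(0, _)"] eq[of "(_, 0)"] by simp_all
  then have "u c' = u' c'" unfolding vector_eq_rdot by (rule prod_eqI)
  then show ?thesis by (rule cot.tangent_eqI[OF c' assms(2,3)])
qed

lemma ham_vec:
  assumes "m \<in> points (cotangent_atlas A)"
    and "differential (cotangent_atlas A) f m \<in> cotangent_space (cotangent_atlas A) m"
  shows "ham_vec A f m \<in> tangent_space (cotangent_atlas A) m"
    and "w \<in> tangent_space (cotangent_atlas A) m
      \<Longrightarrow> Omega_Q A m (ham_vec A f m) w = differential (cotangent_atlas A) f m w"
proof -
  define c' where "c' = chart_at (cotangent_atlas A) m"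
  have c': "c' \<in> charts_at (cotangent_atlas A) m"
    using cot.chart_at_in[OF assms(1)] by (simp add: c'_def)
  obtain z where z: "differential (cotangent_atlas A) f m = coord_covec (cotangent_atlas A) c' m z"
    using assms(2) cot.cotangent_space_eq_range[OF c'] by blast
  let ?P = "\<lambda>Y. Y \<in> tangent_space (cotangent_atlas A) m \<and>
    (\<forall>w\<in>tangent_space (cotangent_atlas A) m. Omega_Q A m Y w = differential (cotangent_atlas A) f m w)"
  \<comment> \<open>The witness is Hamilton's equations: the position part of the field is the
    momentum derivative of \<open>f\<close>, and its momentum part is minus the position
    derivative.\<close>
  have "?P (coord_vec (cotangent_atlas A) c' m (snd z, - fst z))"
    using c' by (auto simp: z coord_covec_def Omega_Q_coords[OF assms(1)] cot.coord_vec_in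
      inner_prod_def inner_commute simp flip: c'_def)
  then have "\<exists>!Y. ?P Y" using Omega_Q_nondegenerate[OF assms(1)] by (intro ex1I) auto
  from theI'[OF this]
  show "ham_vec A f m \<in> tangent_space (cotangent_atlas A) m"
    and "w \<in> tangent_space (cotangent_atlas A) m
      \<Longrightarrow> Omega_Q A m (ham_vec A f m) w = differential (cotangent_atlas A) f m w"
    unfolding ham_vec_def by blast+
qed

end


section \<open>The nonholonomic bivector field\<close>

locale nonholonomic_bivector = cotangent_bundle A
  for A :: "('q, 'e::euclidean_space) atlas" +
  fixes B :: "(('q, 'e) cot, 'm::euclidean_space) atlas"
    and \<epsilon> :: "'q \<Rightarrow> ('q, 'e) tvec \<Rightarrow> real ^ 'k"
    and \<pi> :: "('q, 'e) cot \<Rightarrow> (('q, 'e) cot, 'm) covec \<Rightarrow> (('q, 'e) cot, 'm) covec \<Rightarrow> real"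
  assumes smooth_B: "smooth_manifold B"
    and smooth_incl: "smooth_map B (cotangent_atlas A) (\<lambda>x. x)"
    and linear_constraint: "q \<in> points A \<Longrightarrow> linear_on_sub (tangent_space A q) (\<epsilon> q)"
    and pi_nh: "is_pi_nh A B \<epsilon> \<pi>"
begin

sublocale M: C1_atlas B
  by (rule smooth_manifold_imp_C1_atlas[OF smooth_B])

sublocale incl: C1_map B "cotangent_atlas A" "\<lambda>x. x"
  by (rule smooth_map_imp_C1_map[OF smooth_incl M.C1_atlas_axioms cot.C1_atlas_axioms])

lemma bivector_pi: "bivector_field B \<pi>"
  using pi_nh unfolding is_pi_nh_def by blast

lemma sharp_pi_iff:
  "m \<in> points B \<Longrightarrow> \<alpha> \<in> cotangent_space B m \<Longrightarrow> X \<in> C_dist A B \<epsilon> m \<Longrightarrow>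
    sharp B \<pi> m \<alpha> = - X \<longleftrightarrow> (\<forall>Y\<in>C_dist A B \<epsilon> m. Omega_C A B \<epsilon> m X Y = \<alpha> Y)"
  using pi_nh unfolding is_pi_nh_def by blast

section \<open>The distribution and the two-form at a point\<close>

context
  fixes m
  assumes m: "m \<in> points B"
begin

lemma m_cot: "m \<in> points (cotangent_atlas A)"
  using incl.maps_points[OF m] .

lemma incl_map_in: "incl_map A B m X \<in> tangent_space (cotangent_atlas A) m"
  unfolding incl_map_def using incl.tangent_map_in[OF m] .

lemma linear_on_sub_incl_map: "linear_on_sub (tangent_space B m) (incl_map A B m)"
  unfolding incl_map_def using incl.linear_on_sub_tangent_map[OF m] .

lemma C_distD: "X \<in> C_dist A B \<epsilon> m \<Longrightarrow> X \<in> tangent_space B m"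
  by (simp add: C_dist_def)

lemma mem_C_dist:
  "X \<in> C_dist A B \<epsilon> m \<longleftrightarrow> X \<in> tangent_space B m \<and>
    \<epsilon> (fst m) (tangent_map (cotangent_atlas A) A fst m (incl_map A B m X)) = 0"
  by (simp add: C_dist_def F_dist_def pullback_form_def incl_map_in)

text \<open>\<open>C_dist\<close> is the kernel of \<epsilon> composed with the tangent maps of the
  projection and of the inclusion, each of which is linear on the relevant tangent space.\<close>

lemma subspace_C_dist: "subspace (C_dist A B \<epsilon> m)"
proof -
  have "fst m \<in> points A" using m_cot by (simp add: mem_points_cotangent)
  note lin = linear_on_subD[OF linear_on_sub_incl_map]
    linear_on_subD[OF proj.linear_on_sub_tangent_map[OF m_cot]]
    linear_on_subD[OF linear_constraint[OF this]]
  note in_spaces = incl_map_in proj.tangent_map_in[OF m_cot]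
  show ?thesis
  proof (rule subspaceI)
    have "(0 :: (('q, 'e) cot, 'm) tvec) \<in> tangent_space B m"
      by (rule subspace_0[OF M.subspace_tangent_space])
    \<comment> \<open>Zero is written as a scalar multiple so that the scaling rule of
      \<open>linear_on_sub\<close> yields the value 0.\<close>
    then have "0 *\<^sub>R 0 \<in> C_dist A B \<epsilon> m"
      unfolding mem_C_dist
      by (simp only: lin in_spaces subspace_scale[OF M.subspace_tangent_space])
        (simp add: subspace_0[OF M.subspace_tangent_space])
    then show "0 \<in> C_dist A B \<epsilon> m" by simp
    show "X + Y \<in> C_dist A B \<epsilon> m" if "X \<in> C_dist A B \<epsilon> m" "Y \<in> C_dist A B \<epsilon> m" for X Y
      using that subspace_add[OF M.subspace_tangent_space]
      unfolding mem_C_dist by (simp add: lin in_spaces)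
    show "r *\<^sub>R X \<in> C_dist A B \<epsilon> m" if "X \<in> C_dist A B \<epsilon> m" for r X
      using that subspace_scale[OF M.subspace_tangent_space]
      unfolding mem_C_dist by (simp add: lin in_spaces)
  qed
qed

lemma C_amb_eq: "C_amb A B \<epsilon> m = incl_map A B m ` C_dist A B \<epsilon> m"
  by (auto simp: C_amb_def C_dist_def)

lemma Omega_M_eq: "Omega_M A B m X Y = Omega_Q A m (incl_map A B m X) (incl_map A B m Y)"
  by (simp add: Omega_M_def pullback_two_form_def incl_map_def)

lemma linear_on_sub_Omega_M: "linear_on_sub (tangent_space B m) (\<lambda>X. Omega_M A B m X Y)"
  using linear_on_subD[OF linear_on_sub_incl_map]
    linear_on_subD[OF linear_on_sub_Omega_Q[OF m_cot incl_map_in[of Y]]] incl_map_in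
  by (simp add: linear_on_sub_def Omega_M_eq)

text \<open>The defining equivalence of \<pi> at the zero vector: both its contraction with
  \<open>Omega_C\<close> and the restriction of \<beta> vanish.\<close>

lemma sharp_annihilator:
  assumes "\<beta> \<in> cotangent_space B m" "\<And>Y. Y \<in> C_dist A B \<epsilon> m \<Longrightarrow> \<beta> Y = 0"
  shows "sharp B \<pi> m \<beta> = 0"
proof -
  have "Omega_M A B m 0 Y = 0" for Y
    using linear_on_sub_scaleR[OF linear_on_sub_Omega_M subspace_0[OF M.subspace_tangent_space],
      of 0 Y] by simp
  then have "sharp B \<pi> m \<beta> = - 0"
    using sharp_pi_iff[OF m assms(1) subspace_0[OF subspace_C_dist]] assms(2)
      subspace_0[OF subspace_C_dist] by (simp add: Omega_C_def)
  then show ?thesis by simp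
qed

text \<open>A double annihilator argument. If \<beta> annihilates the distribution, skew-symmetry
  turns its value on the sharp of \<alpha> into minus the value of \<alpha> on the sharp of \<beta>,
  which is zero.\<close>

lemma sharp_in_C_dist:
  assumes "\<alpha> \<in> cotangent_space B m"
  shows "sharp B \<pi> m \<alpha> \<in> C_dist A B \<epsilon> m"
proof (rule M.covector_separates_subspace[OF subspace_C_dist _ m M.sharp_in[OF bivector_pi m assms]])
  show "C_dist A B \<epsilon> m \<subseteq> tangent_space B m" using C_distD by blast
  fix \<beta> assume \<beta>: "\<beta> \<in> cotangent_space B m" "\<And>s. s \<in> C_dist A B \<epsilon> m \<Longrightarrow> \<beta> s = 0"
  have "\<beta> (sharp B \<pi> m \<alpha>) = - \<alpha> (sharp B \<pi> m \<beta>)"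
    using M.sharp_apply[OF bivector_pi m] M.bivector_skew[OF bivector_pi m assms \<beta>(1)] assms \<beta>(1)
    by simp
  moreover have "\<alpha> 0 = 0"
    using linear_on_sub_scaleR[of "tangent_space B m" \<alpha> 0 0] assms
      subspace_0[OF M.subspace_tangent_space] by (simp add: cotangent_space_def)
  ultimately show "\<beta> (sharp B \<pi> m \<alpha>) = 0"
    using sharp_annihilator[OF \<beta>] by simp
qed

text \<open>Once the image of the sharp map is known to lie in the distribution, its negative is an
  admissible vector in the defining equivalence of \<pi>, whose left side then holds
  trivially.\<close>

lemma Omega_M_sharp:
  assumes "\<alpha> \<in> cotangent_space B m" "Y \<in> C_dist A B \<epsilon> m"
  shows "Omega_M A B m (sharp B \<pi> m \<alpha>) Y = - \<alpha> Y"
proof -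
  note X = sharp_in_C_dist[OF assms(1)]
  then have neg: "- sharp B \<pi> m \<alpha> \<in> C_dist A B \<epsilon> m" by (rule subspace_neg[OF subspace_C_dist])
  then have "Omega_C A B \<epsilon> m (- sharp B \<pi> m \<alpha>) Y = \<alpha> Y"
    using sharp_pi_iff[OF m assms(1) neg] assms(2) by simp
  then show ?thesis
    using linear_on_sub_minus[OF linear_on_sub_Omega_M C_distD[OF X]] neg assms(2)
    by (simp add: Omega_C_def)
qed

text \<open>The difference \<open>X - X'\<close> has zero contraction on the distribution, so the
  defining equivalence at the covector 0 makes the sharp of 0 equal to minus this difference. That
  sharp is 0, as the covector 0 annihilates the distribution.\<close>

lemma Omega_M_nondegenerate:
  assumes "X \<in> C_dist A B \<epsilon> m" "X' \<in> C_dist A B \<epsilon> m"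
    and "\<And>Y. Y \<in> C_dist A B \<epsilon> m \<Longrightarrow> Omega_M A B m X Y = Omega_M A B m X' Y"
  shows "X = X'"
proof -
  have diff: "X - X' \<in> C_dist A B \<epsilon> m"
    using subspace_diff[OF subspace_C_dist assms(1,2)] .
  have "Omega_M A B m (X - X') Y = 0" if "Y \<in> C_dist A B \<epsilon> m" for Y
    using linear_on_sub_diff[OF linear_on_sub_Omega_M M.subspace_tangent_space
      C_distD[OF assms(1)] C_distD[OF assms(2)]] assms(3)[OF that] by simp
  then have "sharp B \<pi> m 0 = - (X - X')"
    using sharp_pi_iff[OF m subspace_0[OF M.subspace_cotangent_space[OF m]] diff] diff
    by (simp add: Omega_C_def)
  moreover have "sharp B \<pi> m 0 = 0"
    by (rule sharp_annihilator[OF subspace_0[OF M.subspace_cotangent_space[OF m]]]) simp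
  ultimately show ?thesis by simp
qed

lemma bivector_graph_eq_L_nh: "bivector_graph B \<pi> m = L_nh A B \<epsilon> m"
proof (intro equalityI subrelI)
  fix X \<alpha>
  show "(X, \<alpha>) \<in> L_nh A B \<epsilon> m" if "(X, \<alpha>) \<in> bivector_graph B \<pi> m"
    using that sharp_in_C_dist Omega_M_sharp C_distD[OF sharp_in_C_dist]
    by (auto simp: bivector_graph_def L_nh_def)
  assume "(X, \<alpha>) \<in> L_nh A B \<epsilon> m"
  then have X: "X \<in> C_dist A B \<epsilon> m" "\<And>Y. Y \<in> C_dist A B \<epsilon> m \<Longrightarrow> Omega_M A B m X Y = - \<alpha> Y"
    and \<alpha>: "\<alpha> \<in> cotangent_space B m"
    by (auto simp: L_nh_def)
  \<comment> \<open>Both vectors lie in the distribution and have the same contraction with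
    \<open>Omega_M\<close> there.\<close>
  have "X = sharp B \<pi> m \<alpha>"
    by (rule Omega_M_nondegenerate[OF X(1) sharp_in_C_dist[OF \<alpha>]]) (simp add: X(2) Omega_M_sharp[OF \<alpha>])
  then show "(X, \<alpha>) \<in> bivector_graph B \<pi> m" using \<alpha> by (auto simp: bivector_graph_def)
qed

section \<open>The projector and the classical bracket\<close>

lemma C_projector_eq:
  assumes "v \<in> tangent_space (cotangent_atlas A) m" "X \<in> C_dist A B \<epsilon> m"
    and "\<And>W. W \<in> C_dist A B \<epsilon> m \<Longrightarrow> Omega_Q A m v (incl_map A B m W) = Omega_M A B m X W"
  shows "C_projector A B \<epsilon> m v = incl_map A B m X"
proof -
  \<comment> \<open>Symplectic orthogonality of \<open>v\<close> minus the image of \<open>Z\<close>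
    says that \<open>X\<close> and \<open>Z\<close> have equal contractions on the distribution.
    Hence \<open>Z = X\<close> solves the description defining \<open>C_projector\<close>, and
    nondegeneracy makes it the only solution.\<close>
  have orth: "v - incl_map A B m Z \<in> sympl_orthogonal A m (C_amb A B \<epsilon> m) \<longleftrightarrow>
      (\<forall>W\<in>C_dist A B \<epsilon> m. Omega_M A B m X W = Omega_M A B m Z W)" for Z
    using linear_on_sub_diff[OF linear_on_sub_Omega_Q[OF m_cot incl_map_in]
      cot.subspace_tangent_space assms(1) incl_map_in] assms(3)
    by (simp add: sympl_orthogonal_def C_amb_eq Omega_M_eq
      subspace_diff[OF cot.subspace_tangent_space assms(1) incl_map_in])
  show ?thesis
    unfolding C_projector_def
  proof (rule the_equality)
    show "incl_map A B m X \<in> C_amb A B \<epsilon> m \<and>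
        v - incl_map A B m X \<in> sympl_orthogonal A m (C_amb A B \<epsilon> m)"
      unfolding orth using assms(2) C_amb_eq by blast
    fix u assume u: "u \<in> C_amb A B \<epsilon> m \<and> v - u \<in> sympl_orthogonal A m (C_amb A B \<epsilon> m)"
    then obtain Z where Z: "u = incl_map A B m Z" "Z \<in> C_dist A B \<epsilon> m" by (auto simp: C_amb_eq)
    then have "X = Z" using u Omega_M_nondegenerate[OF assms(2) Z(2)] by (simp add: orth)
    then show "u = incl_map A B m X" using Z by simp
  qed
qed

lemma C_projector_ham_vec:
  assumes "smooth_fun (cotangent_atlas A) (points (cotangent_atlas A)) fbar"
    and "\<And>x. x \<in> points B \<Longrightarrow> fbar x = f x"
    and df: "differential B f m \<in> cotangent_space B m"
  shows "C_projector A B \<epsilon> m (ham_vec A fbar m) =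
    incl_map A B m (- sharp B \<pi> m (differential B f m))"
proof -
  note differentiable = cot.smooth_fun_differentiable[OF assms(1)]
  have cov: "differential (cotangent_atlas A) fbar m \<in> cotangent_space (cotangent_atlas A) m"
    by (rule cot.differential_in_cotangent[OF m_cot differentiable[OF cot.chart_at_in[OF m_cot]]])
  note X = sharp_in_C_dist[OF df]
  show ?thesis
  proof (rule C_projector_eq[OF ham_vec(1)[OF m_cot cov] subspace_neg[OF subspace_C_dist X]])
    fix W assume W: "W \<in> C_dist A B \<epsilon> m"
    have "Omega_Q A m (ham_vec A fbar m) (incl_map A B m W) =
        differential (cotangent_atlas A) fbar m (incl_map A B m W)"
      by (rule ham_vec(2)[OF m_cot cov incl_map_in])
    \<comment> \<open>\<open>fbar\<close> extends \<open>f\<close>, so naturality of the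
      differential under the inclusion applies.\<close>
    also have "\<dots> = differential B f m W"
      unfolding incl_map_def
      by (rule incl.differential_tangent_map[OF m C_distD[OF W] differentiable assms(2)])
    also have "\<dots> = Omega_M A B m (- sharp B \<pi> m (differential B f m)) W"
      using Omega_M_sharp[OF df W] linear_on_sub_minus[OF linear_on_sub_Omega_M C_distD[OF X]] by simp
    finally show "Omega_Q A m (ham_vec A fbar m) (incl_map A B m W) =
        Omega_M A B m (- sharp B \<pi> m (differential B f m)) W" .
  qed
qed

text \<open>Two signs come from the projected Hamiltonian vectors. The first leaves by linearity of
  \<open>Omega_M\<close> in its first argument; the second is taken out of the covector
  \<open>differential B f m\<close>, after \<open>Omega_M_sharp\<close> has replaced the two-form.
  Skew-symmetry then restores the order of \<open>f\<close> and \<open>g\<close>.\<close>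

lemma bracket_eq:
  assumes "smooth_fun B (points B) f" "smooth_fun B (points B) g"
    and "smooth_fun (cotangent_atlas A) (points (cotangent_atlas A)) fbar"
    and "smooth_fun (cotangent_atlas A) (points (cotangent_atlas A)) gbar"
    and "\<And>x. x \<in> points B \<Longrightarrow> fbar x = f x" "\<And>x. x \<in> points B \<Longrightarrow> gbar x = g x"
  shows "bracket B \<pi> f g m = Omega_Q A m (C_projector A B \<epsilon> m (ham_vec A fbar m))
    (C_projector A B \<epsilon> m (ham_vec A gbar m))"
proof -
  have cov: "differential B h m \<in> cotangent_space B m" if "smooth_fun B (points B) h" for h
    by (rule M.differential_in_cotangent[OF m M.smooth_fun_differentiable[OF that M.chart_at_in[OF m]]])
  note df = cov[OF assms(1)] and dg = cov[OF assms(2)]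
  let ?X = "sharp B \<pi> m (differential B f m)" and ?Y = "sharp B \<pi> m (differential B g m)"
  note C = sharp_in_C_dist[OF df] sharp_in_C_dist[OF dg]
  have "Omega_Q A m (C_projector A B \<epsilon> m (ham_vec A fbar m)) (C_projector A B \<epsilon> m (ham_vec A gbar m)) =
      Omega_M A B m (- ?X) (- ?Y)"
    by (simp add: Omega_M_eq C_projector_ham_vec[OF assms(3) assms(5) df]
      C_projector_ham_vec[OF assms(4) assms(6) dg])
  also have "\<dots> = - Omega_M A B m ?X (- ?Y)"
    by (rule linear_on_sub_minus[OF linear_on_sub_Omega_M C_distD[OF C(1)]])
  also have "\<dots> = differential B f m (- ?Y)"
    using Omega_M_sharp[OF df subspace_neg[OF subspace_C_dist C(2)]] by simp
  also have "\<dots> = - differential B f m ?Y"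
    using df by (intro linear_on_sub_minus[OF _ C_distD[OF C(2)]]) (simp add: cotangent_space_def)
  also have "\<dots> = - \<pi> m (differential B g m) (differential B f m)"
    by (simp add: M.sharp_apply[OF bivector_pi m dg df])
  also have "\<dots> = bracket B \<pi> f g m"
    using M.bivector_skew[OF bivector_pi m df dg] by (simp add: bracket_def)
  finally show ?thesis ..
qed

end

end

theorem proposition4p3:
  fixes A :: "('q, 'e::euclidean_space) atlas"
    and G :: "'q \<Rightarrow> ('q, 'e) tvec \<Rightarrow> ('q, 'e) tvec \<Rightarrow> real"
    and V :: "'q \<Rightarrow> real"
    and \<epsilon> :: "'q \<Rightarrow> ('q, 'e) tvec \<Rightarrow> real ^ 'k"
    and B :: "(('q, 'e) cot, 'm::euclidean_space) atlas"
    and \<pi> :: "('q, 'e) cot \<Rightarrow> (('q, 'e) cot, 'm) covec \<Rightarrow> (('q, 'e) cot, 'm) covec \<Rightarrow> real"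
  assumes "nonholonomic_system A G V \<epsilon>"
    and "embedded_submanifold B (cotangent_atlas A)"
    and "points B = constraint_submanifold A G V \<epsilon>"
    and "is_pi_nh A B \<epsilon> \<pi>"
  shows "(almost_dirac B (bivector_graph B \<pi>) \<and> almost_dirac B (L_nh A B \<epsilon>) \<and>
          (\<forall>m\<in>points B. bivector_graph B \<pi> m = L_nh A B \<epsilon> m)) \<and>
    (\<forall>f g fbar gbar.
       smooth_fun B (points B) f \<and> smooth_fun B (points B) g \<and>
       smooth_fun (cotangent_atlas A) (points (cotangent_atlas A)) fbar \<and>
       smooth_fun (cotangent_atlas A) (points (cotangent_atlas A)) gbar \<and>
       (\<forall>m\<in>points B. fbar m = f m \<and> gbar m = g m) \<longrightarrow>
       (\<forall>m\<in>points B. bracket B \<pi> f g m =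
          Omega_Q A m (C_projector A B \<epsilon> m (ham_vec A fbar m))
                      (C_projector A B \<epsilon> m (ham_vec A gbar m))))"
proof -
  interpret nonholonomic_bivector A B \<epsilon> \<pi>
  proof
    show "smooth_manifold A" "smooth_manifold B" "smooth_map B (cotangent_atlas A) (\<lambda>x. x)"
      "is_pi_nh A B \<epsilon> \<pi>"
      using assms unfolding nonholonomic_system_def embedded_submanifold_def by blast+
    show "linear_on_sub (tangent_space A q) (\<epsilon> q)" if "q \<in> points A" for q
      using assms(1) that unfolding nonholonomic_system_def smooth_one_form_def by blast
  qed
  have graph: "almost_dirac B (bivector_graph B \<pi>)"
    by (rule M.almost_dirac_bivector_graph[OF bivector_pi smooth_B])
  \<comment> \<open>The almost Dirac property is proved for the graph and carried over by the
    equality of fibres at the points of \<open>B\<close>.\<close>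
  have "almost_dirac B (L_nh A B \<epsilon>)"
    by (rule M.almost_dirac_cong[OF bivector_graph_eq_L_nh graph])
  with graph show ?thesis
    by (intro conjI ballI allI impI bivector_graph_eq_L_nh bracket_eq) auto
qed

end
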